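(* For every real $u>0$, $$2\log G(1+u)=-\sum_{n=0}^{\infty}\frac{1}{n+1}\sum_{k=0}^{n}\binom{n}{k}(-1)^k(u+k)^2\log(u+k)+2u\log\Gamma(u)+2u^2-u+2\varsigma'(-1)-\frac{11}{12}-\frac12(u-1)(3u+2).$$
   Context: $\Gamma$ is the Euler gamma function, $\varsigma$ is the (analytically continued) Riemann zeta function and $\varsigma'$ its derivative. $G$ is the Barnes $G$-function (the reciprocal of the Barnes double gamma function, $\Gamma_2=1/G$), defined by $$G(1+x)=(2\pi)^{x/2}\exp\left[-\tfrac12(\gamma x^2+x^2+x)\right]\prod_{k=1}^{\infty}\left\{\left(1+\frac{x}{k}\right)^k\exp\left(\frac{x^2}{2k}-x\right)\right\},$$ where $\gamma$ is Euler's constant; it satisfies $G(1)=1$ and $G(1+x)=\Gamma(x)G(x)$. $\log$ is the real natural logarithm, and the outer series is summed in the order written (sum over $n$ of the finite inner sums). *)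

theory Defs
  imports "HOL-Complex_Analysis.Complex_Analysis"
begin

text \<open>
  The Barnes \<open>G\<close>-function on the reals, as the Weierstrass product in \<open>x = z - 1\<close>; the index
  \<open>k\<close> below starts at 0, so it stands for \<open>k + 1\<close> in the usual product over \<open>k \<ge> 1\<close>.
\<close>

definition Barnes_G :: "real \<Rightarrow> real" where
  "Barnes_G z = (let x = z - 1 in
     (2 * pi) powr (x / 2) * exp (- (1 / 2) * (euler_mascheroni * x\<^sup>2 + x\<^sup>2 + x)) *
     (\<Prod>k. (1 + x / real (Suc k)) ^ Suc k * exp (x\<^sup>2 / (2 * real (Suc k)) - x)))"

definition is_zeta_continuation :: "(complex \<Rightarrow> complex) \<Rightarrow> bool" where
  "is_zeta_continuation f \<longleftrightarrow> f holomorphic_on - {1} \<and>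
     (\<forall>s. Re s > 1 \<longrightarrow> (\<lambda>n. 1 / of_nat (Suc n) powr s) sums f s)"

text \<open>
  The Riemann zeta function. A continuation exists by the classical theory, and the choice only
  leaves the value at the pole 1 unspecified: see \<open>is_zeta_continuation_unique\<close>.
\<close>

definition zeta :: "complex \<Rightarrow> complex" where
  "zeta = (SOME f. is_zeta_continuation f)"

lemma is_zeta_continuation_unique:
  assumes f: "is_zeta_continuation f" and g: "is_zeta_continuation g" and "s \<noteq> 1"
  shows "f s = g s"
proof (rule analytic_continuation_open[where f = f and g = g and s = "{s. Re s > 1}" and s' = "- {1}"])
  show "open {s. Re s > 1}"
    by (rule open_halfspace_Re_gt)
  show "connected (- {1 :: complex})"
    by (rule connected_punctured_universe) simp
  have "2 \<in> {s. Re s > 1}"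
    by simp
  thus "{s. Re s > 1} \<noteq> {}"
    by blast
qed (use assms in \<open>auto simp: is_zeta_continuation_def intro: sums_unique2\<close>)

end

theory Submission
  imports Defs "HOL-Real_Asymp.Real_Asymp"
begin

text \<open>
  Write \<open>S u\<close> for the series of the theorem. It is, up to sign, the derivative at \<open>w = - 2\<close> of
  Hasse's series \<open>h w u = \<Sum>n. (1 / (n + 1)) \<Sum>k. (-1)\<^sup>k (n choose k) (u + k) powr (- w)\<close>, whose value is
  \<open>w\<close> times the Hurwitz zeta function at \<open>(w + 1, u)\<close>.

  The convergence of Hasse's series, locally uniformly in \<open>w\<close>, rests on the elementary bound
  \<open>norm_adiff_cpow_le\<close> for the differences of a power, extended to growing powers by the mean value
  theorem. The same bound shows that the Newton series for the derivative of a power converges,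
  which is the difference equation \<open>h w (u + 1) = h w u - w u powr (- w - 1)\<close> (\<open>hasse_shift\<close>). For
  \<open>Re s > 1\<close> and large \<open>Y\<close> this turns \<open>h (s - 1) (Y + 1) / (s - 1)\<close> into the tail of the Dirichlet
  series of zeta; adding the first \<open>Y\<close> terms gives the continuation to the punctured plane, with
  \<open>Y\<close> growing with the modulus of \<open>s\<close>, and near \<open>s = - 1\<close> the
  continuation is \<open>h (s - 1) 1 / (s - 1)\<close> itself. Differentiation there gives
  \<open>2 \<zeta>'(- 1) = S 1 - 1 / 12\<close> (\<open>deriv_zeta_minus_one\<close>).

  Differentiating the difference equation in \<open>w\<close> gives \<open>S (u + 1) = S u + u + 2 u ln u\<close>, and \<open>S y\<close>
  is the sum of its first three terms up to an error that tends to \<open>0\<close> as \<open>y \<rightarrow> \<infinity>\<close>. So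
  \<open>S u\<close>, \<open>ln G (1 + u)\<close> and \<open>ln \<Gamma>(u)\<close> are all limits of explicit finite sums, and in the
  combination \<open>2 ln G (1 + u) - 2 u ln \<Gamma>(u) + S u - (u\<^sup>2 - u) / 2\<close> everything that depends on \<open>u\<close>
  cancels in the limit, by Stirling's formula and the definition of Euler's constant
  (\<open>barnes_limit_seq_tendsto\<close>). The constant is \<open>S 1\<close>, as \<open>G(2) = \<Gamma>(1) = 1\<close>.
\<close>

section \<open>Iterated differences\<close>

text \<open>
  The iterated difference, signed so that one step sends \<open>g\<close> to \<open>g y - g (y + 1)\<close>; the
  \<open>n\<close>-th iterate is the alternating binomial sum of Hasse's series.
\<close>

primrec adiff :: "nat \<Rightarrow> (real \<Rightarrow> complex) \<Rightarrow> real \<Rightarrow> complex" where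
  "adiff 0 g = g"
| "adiff (Suc n) g = (\<lambda>y. adiff n g y - adiff n g (y + 1))"

lemma adiff_binomial:
  "adiff n g y = (\<Sum>k\<le>n. of_nat (n choose k) * (- 1) ^ k * g (y + real k))"
proof (induction n arbitrary: y)
  case (Suc n)
  have "(\<Sum>k\<le>Suc n. of_nat (Suc n choose k) * (- 1) ^ k * g (y + real k)) =
      g y + (\<Sum>k\<le>n. of_nat (Suc n choose Suc k) * (- 1) ^ Suc k * g (y + real (Suc k)))"
    by (subst sum.atMost_Suc_shift) simp
  also have "\<dots> = g y + (\<Sum>k\<le>n. of_nat (n choose Suc k) * (- 1) ^ Suc k * g (y + real (Suc k)))
      - (\<Sum>k\<le>n. of_nat (n choose k) * (- 1) ^ k * g (y + 1 + real k))"
    by (simp add: sum_subtractf[symmetric] sum.distrib[symmetric] algebra_simps sum_negf)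
  also have "g y + (\<Sum>k\<le>n. of_nat (n choose Suc k) * (- 1) ^ Suc k * g (y + real (Suc k))) =
      (\<Sum>k\<le>Suc n. of_nat (n choose k) * (- 1) ^ k * g (y + real k))"
    by (subst sum.atMost_Suc_shift) simp
  also have "\<dots> = (\<Sum>k\<le>n. of_nat (n choose k) * (- 1) ^ k * g (y + real k))"
    by simp
  finally show ?case by (simp add: Suc)
qed simp

lemma adiff_cong:
  assumes "\<And>x. x \<ge> y \<Longrightarrow> f x = g x"
  shows "adiff n f y = adiff n g y"
  using assms by (simp add: adiff_binomial)

lemma adiff_cmult: "adiff n (\<lambda>x. c * g x) y = c * adiff n g y"
  by (induction n arbitrary: y) (simp_all add: algebra_simps)

text \<open>
  A Leibniz rule for multiplication by the variable. It drives every recursion below: read with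
  \<open>g\<close> a power it bounds differences by earlier ones, and summed over \<open>n\<close> it relates the Newton
  series for the derivatives of \<open>g\<close> and of \<open>x \<mapsto> x g(x)\<close>.
\<close>

lemma adiff_of_real_mult:
  "adiff (Suc n) (\<lambda>x. of_real x * g x) y =
     (of_real y + of_nat (Suc n)) * adiff (Suc n) g y - of_nat (Suc n) * adiff n g y"
proof (induction n arbitrary: y)
  case (Suc n)
  show ?case
    by (subst adiff.simps, subst (1 2) Suc) (simp add: algebra_simps)
qed (simp add: algebra_simps)

lemma adiff_has_vector_derivative:
  assumes "\<And>x. x \<ge> y \<Longrightarrow> (g has_vector_derivative g' x) (at x)"
  shows "(adiff n g has_vector_derivative adiff n g' y) (at y)"
  using assms
proof (induction n arbitrary: y)
  case (Suc n)
  have 1: "(adiff n g has_vector_derivative adiff n g' y) (at y)"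
    by (rule Suc.IH) (use Suc.prems in auto)
  have 2: "(adiff n g has_vector_derivative adiff n g' (y + 1)) (at (y + 1))"
    by (rule Suc.IH) (use Suc.prems in auto)
  have "((adiff n g \<circ> (\<lambda>x. x + 1)) has_vector_derivative (1 *\<^sub>R adiff n g' (y + 1))) (at y)"
    by (rule vector_diff_chain_at) (auto intro!: derivative_eq_intros 2
        simp: has_real_derivative_iff_has_vector_derivative[symmetric])
  thus ?case
    using 1 by (auto intro!: derivative_eq_intros simp: o_def)
qed simp

text \<open>
  The mean value theorem trades one difference for one derivative. This lowers the exponent of a
  power, and so reaches powers that grow.
\<close>

lemma norm_adiff_Suc_le:
  assumes "\<And>x. x \<ge> y \<Longrightarrow> (g has_vector_derivative g' x) (at x)"
    and "\<And>t. t \<ge> y \<Longrightarrow> norm (adiff n g' t) \<le> B"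
  shows "norm (adiff (Suc n) g y) \<le> B"
proof -
  have der: "(adiff n g has_vector_derivative adiff n g' t) (at t)" if "t \<ge> y" for t
    by (rule adiff_has_vector_derivative) (use assms that in auto)
  have "norm (adiff n g (y + 1) - adiff n g y) \<le> B * (y + 1) - B * y"
  proof (rule differentiable_bound_general)
    show "continuous_on {y..y + 1} (adiff n g)"
      using der by (intro continuous_at_imp_continuous_on ballI)
        (auto intro: has_vector_derivative_continuous)
  qed (auto intro!: derivative_eq_intros der assms continuous_intros
       simp: has_real_derivative_iff_has_vector_derivative[symmetric])
  thus ?thesis
    by (simp add: norm_minus_commute algebra_simps)
qed

section \<open>Differences of complex powers\<close>

text \<open>
  The function \<open>x\<close> to the power \<open>- w\<close> for \<open>x > 0\<close>, written with the real logarithm, so that it is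
  visibly entire in \<open>w\<close>.
\<close>

definition cpow :: "complex \<Rightarrow> real \<Rightarrow> complex" where
  "cpow w x = exp (- w * of_real (ln x))"

lemma cpow_powr: "x > 0 \<Longrightarrow> cpow w x = of_real x powr (- w)"
  by (simp add: cpow_def powr_def Ln_of_real)

lemma norm_cpow: "x > 0 \<Longrightarrow> norm (cpow w x) = x powr (- Re w)"
  by (simp add: cpow_def powr_def)

lemma cpow_mult: "cpow v x * cpow w x = cpow (v + w) x"
  by (simp add: cpow_def exp_add[symmetric] algebra_simps)

lemma cpow_minus_one: "x > 0 \<Longrightarrow> cpow (- 1) x = of_real x"
  by (simp add: cpow_def exp_of_real)

lemma of_real_mult_cpow: "x > 0 \<Longrightarrow> of_real x * cpow (w + 1) x = cpow w x"
  using cpow_mult[of "-1" x "w + 1"] by (simp add: cpow_minus_one)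

lemma cpow_has_vector_derivative:
  assumes "x > 0"
  shows "(cpow w has_vector_derivative (- w * cpow (w + 1) x)) (at x)"
proof -
  have "((\<lambda>x. - w * of_real (ln x)) has_vector_derivative (- w * of_real (1 / x))) (at x)"
    using assms by (auto intro!: derivative_eq_intros
        simp: has_real_derivative_iff_has_vector_derivative[symmetric] has_vector_derivative_def
        divide_inverse mult_ac scaleR_conv_of_real)
  from field_vector_diff_chain_at[OF this DERIV_exp]
  have "(cpow w has_vector_derivative (- w * of_real (1 / x)) * cpow w x) (at x)"
    by (simp add: o_def cpow_def[abs_def])
  moreover have "(- w * of_real (1 / x)) * cpow w x = - w * cpow (w + 1) x"
    using assms of_real_mult_cpow[OF assms, of w] by (simp add: field_simps)
  ultimately show ?thesis by simp
qed

text \<open>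
  The majorant for differences of powers. It decays like \<open>n\<close> to the power \<open>C - y\<close>; only the
  consequences proved below for \<open>0 \<le> C < y\<close> matter, and they follow from the telescoping
  identity \<open>rising_quot_diff\<close>.
\<close>

definition rising_quot :: "nat \<Rightarrow> real \<Rightarrow> real \<Rightarrow> real" where
  "rising_quot n C y = (\<Prod>k=1..n. (real k + C) / (real k + y))"

lemma rising_quot_0 [simp]: "rising_quot 0 C y = 1"
  by (simp add: rising_quot_def)

lemma rising_quot_Suc: "rising_quot (Suc n) C y = rising_quot n C y * ((real (Suc n) + C) / (real (Suc n) + y))"
  by (simp add: rising_quot_def)

context
  fixes C y :: real
  assumes C: "0 \<le> C" "C < y"
begin

lemma rising_quot_nonneg: "rising_quot n C y \<ge> 0"
  using C by (auto simp: rising_quot_def intro!: prod_nonneg)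

lemma rising_quot_Suc_le: "rising_quot (Suc n) C y \<le> rising_quot n C y"
proof -
  have "rising_quot n C y * ((real (Suc n) + C) / (real (Suc n) + y)) \<le> rising_quot n C y * 1"
    using C by (intro mult_left_mono rising_quot_nonneg) (auto simp: field_simps)
  thus ?thesis by (simp add: rising_quot_Suc)
qed

lemma rising_quot_diff: "rising_quot n C y - rising_quot (Suc n) C y = (y - C) * (rising_quot n C y / (real (Suc n) + y))"
  using C by (simp add: rising_quot_Suc field_simps)

lemma rising_quot_convergent: "convergent (\<lambda>n. rising_quot n C y)"
  by (intro Bseq_monoseq_convergent BseqI'[of _ 1] decseq_imp_monoseq decseq_SucI rising_quot_Suc_le)
     (use C in \<open>auto simp: rising_quot_def abs_prod intro!: prod_le_1\<close>)

lemma rising_quot_sums: "(\<lambda>n. rising_quot n C y / (real (Suc n) + y)) sums ((1 - lim (\<lambda>n. rising_quot n C y)) / (y - C))"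
proof -
  have "(\<lambda>n. rising_quot n C y - rising_quot (Suc n) C y) sums (rising_quot 0 C y - lim (\<lambda>n. rising_quot n C y))"
    by (rule telescope_sums') (use rising_quot_convergent in \<open>simp add: convergent_LIMSEQ_iff\<close>)
  from sums_divide[OF this, of "y - C"] show ?thesis
    using C by (simp add: rising_quot_diff)
qed

lemma rising_quot_summable: "summable (\<lambda>n. rising_quot n C y / real (Suc n))"
proof (rule summable_comparison_test')
  show "summable (\<lambda>n. (1 + y) * (rising_quot n C y / (real (Suc n) + y)))"
    using rising_quot_sums by (intro summable_mult) (auto simp: sums_iff)
  fix n
  have "real (Suc n) + y \<le> (1 + y) * real (Suc n)"
    using C by (simp add: algebra_simps)
  hence "1 / real (Suc n) \<le> (1 + y) / (real (Suc n) + y)"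
    using C by (simp add: field_simps)
  from mult_left_mono[OF this rising_quot_nonneg[of n]]
  show "norm (rising_quot n C y / real (Suc n)) \<le> (1 + y) * (rising_quot n C y / (real (Suc n) + y))"
    using rising_quot_nonneg[of n] by (simp add: mult_ac)
qed

lemma rising_quot_tendsto_0: "(\<lambda>n. rising_quot n C y) \<longlonglongrightarrow> 0"
proof -
  obtain L where L: "(\<lambda>n. rising_quot n C y) \<longlonglongrightarrow> L"
    using rising_quot_convergent by (auto simp: convergent_def)
  have le: "L \<le> rising_quot n C y" for n
    by (rule decseq_ge[OF decseq_SucI L]) (rule rising_quot_Suc_le)
  have "L \<ge> 0"
    by (rule LIMSEQ_le_const[OF L]) (use rising_quot_nonneg in auto)
  \<comment> \<open>A positive limit would contradict the divergence of the harmonic series.\<close>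
  have "summable (\<lambda>n. L * (1 / real (Suc n)))"
    by (rule summable_comparison_test'[OF rising_quot_summable, of 0])
       (use le \<open>L \<ge> 0\<close> in \<open>auto simp: divide_right_mono\<close>)
  hence "L = 0"
    using not_summable_harmonic[where 'a = real] 
    by (subst (asm) summable_cmult_iff, subst (asm) summable_Suc_iff) (auto simp: inverse_eq_divide)
  thus ?thesis using L by simp
qed

end

lemma norm_adiff_Suc_cpow_le_of_bound:
  assumes y: "0 < t" and "norm v \<le> C"
    and B: "\<And>x. x \<ge> t \<Longrightarrow> norm (adiff n (cpow (v + 1)) x) \<le> B"
  shows "norm (adiff (Suc n) (cpow v) t) \<le> C * B"
proof (rule norm_adiff_Suc_le)
  fix x assume x: "x \<ge> t"
  show "(cpow v has_vector_derivative - v * cpow (v + 1) x) (at x)"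
    using x y by (intro cpow_has_vector_derivative) auto
  have "norm v * norm (adiff n (cpow (v + 1)) x) \<le> C * B"
    using B[OF x] assms(2) order_trans[OF norm_ge_zero assms(2)] by (intro mult_mono) auto
  thus "norm (adiff n (\<lambda>x. - v * cpow (v + 1) x) x) \<le> C * B"
    by (subst adiff_cmult) (simp add: norm_mult)
qed

lemma adiff_cpow_rec:
  assumes "y > 0"
  shows "adiff (Suc n) (cpow w) y =
     (of_real y + of_nat (Suc n)) * adiff (Suc n) (cpow (w + 1)) y - of_nat (Suc n) * adiff n (cpow (w + 1)) y"
proof -
  have "adiff (Suc n) (cpow w) y = adiff (Suc n) (\<lambda>x. of_real x * cpow (w + 1) x) y"
    by (rule adiff_cong) (use assms in \<open>simp add: of_real_mult_cpow\<close>)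
  thus ?thesis by (simp only: adiff_of_real_mult)
qed

text \<open>
  The basic estimate. The mean value theorem bounds the differences of the power with exponent \<open>- v\<close> by those with
  exponent \<open>- v - 1\<close>, while the Leibniz rule goes the other way and gains the factor
  \<open>1 / (t + n + 1)\<close>; together they give a first-order recursion in \<open>n\<close>.
\<close>

lemma norm_adiff_cpow_le:
  assumes C: "0 \<le> C" "C < y" and v: "norm v \<le> C" "Re v \<ge> - 1" and t: "t \<ge> y"
  shows "norm (adiff n (cpow (v + 1)) t) \<le> rising_quot n C y * t powr (- Re v - 1)"
  using t
proof (induction n arbitrary: t)
  case 0
  thus ?case using C by (simp add: norm_cpow)
next
  case (Suc n)
  define p where "p = t powr (- Re v - 1)"
  have t: "t > 0" "t \<ge> y" using C Suc.prems by auto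
  have "norm (adiff n (cpow (v + 1)) x) \<le> rising_quot n C y * p" if "x \<ge> t" for x
  proof -
    have "x powr (- Re v - 1) \<le> p"
      unfolding p_def using that t v by (intro powr_mono2') auto
    hence "rising_quot n C y * x powr (- Re v - 1) \<le> rising_quot n C y * p"
      by (intro mult_left_mono rising_quot_nonneg C)
    with Suc.IH[of x] that t show ?thesis by simp
  qed
  hence 1: "norm (adiff (Suc n) (cpow v) t) \<le> C * (rising_quot n C y * p)"
    by (intro norm_adiff_Suc_cpow_le_of_bound v t) auto
  have "(of_real t + of_nat (Suc n)) * adiff (Suc n) (cpow (v + 1)) t =
          adiff (Suc n) (cpow v) t + of_nat (Suc n) * adiff n (cpow (v + 1)) t"
    by (simp only: adiff_cpow_rec[OF t(1), of n v] diff_add_cancel)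
  hence "norm ((of_real t + of_nat (Suc n)) * adiff (Suc n) (cpow (v + 1)) t) =
          norm (adiff (Suc n) (cpow v) t + of_nat (Suc n) * adiff n (cpow (v + 1)) t)"
    by (simp only:)
  also have "norm ((of_real t + of_nat (Suc n)) * adiff (Suc n) (cpow (v + 1)) t) =
     (t + real (Suc n)) * norm (adiff (Suc n) (cpow (v + 1)) t)"
  proof -
    have "of_real t + of_nat (Suc n) = complex_of_real (t + real (Suc n))" by simp
    thus ?thesis using t by (simp only: norm_mult norm_of_real)
  qed
  also have "norm (adiff (Suc n) (cpow v) t + of_nat (Suc n) * adiff n (cpow (v + 1)) t)
     \<le> C * (rising_quot n C y * p) + real (Suc n) * (rising_quot n C y * p)"
    using 1 Suc.IH[OF t(2)] by (intro norm_triangle_mono) (auto simp: norm_mult p_def simp del: adiff.simps of_nat_Suc)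
  finally have "norm (adiff (Suc n) (cpow (v + 1)) t) \<le> (real (Suc n) + C) / (t + real (Suc n)) * (rising_quot n C y * p)"
    using t by (simp add: field_simps)
  also have "\<dots> \<le> (real (Suc n) + C) / (real (Suc n) + y) * (rising_quot n C y * p)"
    using t C by (intro mult_right_mono divide_left_mono mult_nonneg_nonneg rising_quot_nonneg) (auto simp: p_def)
  finally show ?case
    by (simp add: rising_quot_Suc p_def mult_ac)
qed

text \<open>
  The estimate for powers that may grow: \<open>i\<close> of the differences are spent on derivatives.
\<close>

lemma norm_adiff_cpow_shift_le:
  assumes C: "0 \<le> C" "C < y" and v: "norm v \<le> C" "Re v \<ge> - 1" and t: "t \<ge> y"
  shows "norm (adiff (n + i) (cpow (v + 1 - of_nat i)) t)
           \<le> (C + real i) ^ i * (rising_quot n C y * t powr (- Re v - 1))"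
  using t
proof (induction i arbitrary: t)
  case 0
  thus ?case using norm_adiff_cpow_le[OF C v] by simp
next
  case (Suc i)
  define p where "p = t powr (- Re v - 1)"
  have t: "t > 0" "t \<ge> y" using C Suc.prems by auto
  have p: "rising_quot n C y * p \<ge> 0" by (intro mult_nonneg_nonneg rising_quot_nonneg C) (auto simp: p_def)
  have "norm (adiff (n + i) (cpow ((v - of_nat i) + 1)) x) \<le> (C + real i) ^ i * (rising_quot n C y * p)" if "x \<ge> t" for x
  proof -
    have "x powr (- Re v - 1) \<le> p"
      unfolding p_def using that t v by (intro powr_mono2') auto
    hence "(C + real i) ^ i * (rising_quot n C y * x powr (- Re v - 1)) \<le> (C + real i) ^ i * (rising_quot n C y * p)"
      using C by (intro mult_left_mono rising_quot_nonneg C) auto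
    with Suc.IH[of x] that t show ?thesis by (simp add: algebra_simps)
  qed
  moreover have "norm (v - of_nat i) \<le> C + real i"
    using norm_triangle_ineq4[of v "of_nat i"] v by simp
  ultimately have "norm (adiff (Suc (n + i)) (cpow (v - of_nat i)) t) \<le> (C + real i) * ((C + real i) ^ i * (rising_quot n C y * p))"
    by (intro norm_adiff_Suc_cpow_le_of_bound t) auto
  also have "\<dots> = (C + real i) ^ Suc i * (rising_quot n C y * p)" by simp
  also have "\<dots> \<le> (C + real (Suc i)) ^ Suc i * (rising_quot n C y * p)"
    using C by (intro mult_right_mono power_mono p) auto
  finally show ?case by (simp add: p_def)
qed

lemma powr_le_one_plus_powr:
  assumes "y > (0::real)" "- C - 1 \<le> a" "a \<le> 0"
  shows "y powr a \<le> 1 + y powr (- C - 1)"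
proof (cases "y \<ge> 1")
  case True
  hence "y powr a \<le> 1" using assms powr_mono[of a 0 y] by simp
  thus ?thesis by (simp add: add_increasing2)
next
  case False
  hence "y powr a \<le> y powr (- C - 1)" using assms by (intro powr_mono') auto
  thus ?thesis by simp
qed

text \<open>
  A bound at the fixed point \<open>y\<close>, uniform for \<open>w\<close> in the disc of radius \<open>C < y\<close> around \<open>- j\<close>, or
  in its part with \<open>Re (w + j) \<ge> - 1\<close> if the disc is larger than that.
\<close>

lemma norm_adiff_cpow_uniform:
  assumes C: "0 \<le> C" "C < y"
  obtains K where "K \<ge> 0" "\<And>n w. norm (w + of_nat j) \<le> C \<Longrightarrow> Re (w + of_nat j) \<ge> - 1 \<Longrightarrow>
     norm (adiff (n + Suc j) (cpow w) y) \<le> K * rising_quot n C y"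
proof
  let ?K = "(C + real (Suc j)) ^ Suc j * (1 + y powr (- C - 1))"
  show "?K \<ge> 0" using C by simp
  fix n and w :: complex
  assume w: "norm (w + of_nat j) \<le> C" "Re (w + of_nat j) \<ge> - 1"
  have "\<bar>Re (w + of_nat j)\<bar> \<le> C"
    using abs_Re_le_cmod w(1) order_trans by blast
  hence p: "y powr (- Re (w + of_nat j) - 1) \<le> 1 + y powr (- C - 1)"
    using C w by (intro powr_le_one_plus_powr) auto
  have "norm (adiff (n + Suc j) (cpow ((w + of_nat j) + 1 - of_nat (Suc j))) y)
     \<le> (C + real (Suc j)) ^ Suc j * (rising_quot n C y * y powr (- Re (w + of_nat j) - 1))"
    by (rule norm_adiff_cpow_shift_le) (use C w in auto)
  also have "\<dots> \<le> (C + real (Suc j)) ^ Suc j * (rising_quot n C y * (1 + y powr (- C - 1)))"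
    using C by (intro mult_left_mono p rising_quot_nonneg) auto
  finally show "norm (adiff (n + Suc j) (cpow w) y) \<le> ?K * rising_quot n C y"
    by (simp add: mult_ac)
qed

section \<open>Hasse's series\<close>

text \<open>
  Hasse's series. Where it converges its value is \<open>w\<close> times the Hurwitz zeta function at
  \<open>(w + 1, y)\<close>.
\<close>

definition hasse :: "complex \<Rightarrow> real \<Rightarrow> complex" where
  "hasse w y = (\<Sum>n. adiff n (cpow w) y / of_nat (Suc n))"

lemma adiff_cpow_has_field_derivative:
  "((\<lambda>w. adiff n (cpow w) y) has_field_derivative adiff n (\<lambda>x. - of_real (ln x) * cpow w x) y) (at w)"
proof (induction n arbitrary: y)
  case 0
  show ?case by (auto simp: cpow_def intro!: derivative_eq_intros)
next
  case (Suc n)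
  show ?case by (auto intro!: derivative_eq_intros Suc)
qed

lemma hasse_has_derivative:
  assumes C: "0 \<le> C" "C < y" and S: "open S"
    and w: "\<And>w. w \<in> S \<Longrightarrow> norm (w + of_nat j) \<le> C" "\<And>w. w \<in> S \<Longrightarrow> Re (w + of_nat j) \<ge> - 1"
    and "w \<in> S"
  shows "(\<lambda>n. adiff n (cpow w) y / of_nat (Suc n)) sums hasse w y" (is ?A)
    and "summable (\<lambda>n. adiff n (\<lambda>x. - of_real (ln x) * cpow w x) y / of_nat (Suc n))" (is ?B)
    and "((\<lambda>w. hasse w y) has_field_derivative
            (\<Sum>n. adiff n (\<lambda>x. - of_real (ln x) * cpow w x) y / of_nat (Suc n))) (at w)" (is ?C)
proof -
  obtain K where K: "K \<ge> 0" "\<And>n w. norm (w + of_nat j) \<le> C \<Longrightarrow> Re (w + of_nat j) \<ge> - 1 \<Longrightarrow>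
     norm (adiff (n + Suc j) (cpow w) y) \<le> K * rising_quot n C y"
    using norm_adiff_cpow_uniform[OF C] by metis
  define h where "h = (\<lambda>n. K * (rising_quot (n - Suc j) C y / real (Suc (n - Suc j))))"
  have "summable (\<lambda>n. h (n + Suc j))"
    unfolding h_def add_diff_cancel_right' by (intro summable_mult rising_quot_summable C)
  hence h: "summable h" by (subst (asm) summable_iff_shift)
  have le: "\<forall>\<^sub>F n in sequentially. \<forall>w\<in>S. norm (adiff n (cpow w) y / of_nat (Suc n)) \<le> h n"
    using eventually_ge_at_top[of "Suc j"]
  proof eventually_elim
    case (elim n)
    then obtain m where n: "n = m + Suc j" by (metis le_add_diff_inverse2)
    show ?case
    proof
      fix w assume "w \<in> S"
      hence "norm (adiff n (cpow w) y) \<le> K * rising_quot m C y"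
        unfolding n by (intro K w)
      hence "norm (adiff n (cpow w) y / of_nat (Suc n)) \<le> (K * rising_quot m C y) / real (Suc n)"
        unfolding norm_divide norm_of_nat by (intro divide_right_mono) auto
      also have "\<dots> \<le> (K * rising_quot m C y) / real (Suc m)"
        using K rising_quot_nonneg[OF C, of m] by (intro divide_left_mono) (auto simp: n)
      finally show "norm (adiff n (cpow w) y / of_nat (Suc n)) \<le> h n"
        by (simp add: h_def n)
    qed
  qed
  obtain g g' where g: "\<forall>w\<in>S. (\<lambda>n. adiff n (cpow w) y / of_nat (Suc n)) sums g w \<and>
      (\<lambda>n. adiff n (\<lambda>x. - of_real (ln x) * cpow w x) y / of_nat (Suc n)) sums g' w \<and>
      (g has_field_derivative g' w) (at w)"
    by (rule series_and_derivative_comparison[OF S h _ le])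
       (rule DERIV_cdivide[OF adiff_cpow_has_field_derivative], blast)
  have eq: "g w = hasse w y" if "w \<in> S" for w
    using g that by (auto simp: hasse_def sums_iff)
  show ?A ?B
    using g \<open>w \<in> S\<close> eq by (auto simp: sums_iff)
  have "((\<lambda>w. hasse w y) has_field_derivative g' w) (at w)"
    by (rule has_field_derivative_transform_within_open[of g _ _ S]) (use S g eq \<open>w \<in> S\<close> in auto)
  moreover have "(\<Sum>n. adiff n (\<lambda>x. - of_real (ln x) * cpow w x) y / of_nat (Suc n)) = g' w"
    using g \<open>w \<in> S\<close> by (intro sums_unique[symmetric]) blast
  ultimately show ?C by simp
qed

lemma hasse_sums:
  assumes "norm (w + of_nat j) < y" "Re (w + of_nat j) > - 1"
  shows "(\<lambda>n. adiff n (cpow w) y / of_nat (Suc n)) sums hasse w y"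
proof -
  obtain C where C: "norm (w + of_nat j) < C" "C < y"
    using dense[OF assms(1)] by blast
  hence "0 \<le> C" using norm_ge_zero[of "w + of_nat j"] by linarith
  show ?thesis
  proof (rule hasse_has_derivative(1)[OF \<open>0 \<le> C\<close> \<open>C < y\<close>, where j = j])
    show "open {w. norm (w + of_nat j) < C \<and> Re (w + of_nat j) > - 1}"
      by (intro open_Collect_conj open_Collect_less continuous_intros)
  qed (use C assms in auto)
qed

text \<open>
  The error, after \<open>N\<close> terms, of the Newton series \<open>\<Sum>n. adiff (Suc n) g y / (n + 1) = - g' y\<close>
  for \<open>g = cpow w\<close>.
\<close>

definition newton_defect :: "nat \<Rightarrow> complex \<Rightarrow> real \<Rightarrow> complex" where
  "newton_defect N w y = (\<Sum>n<N. adiff (Suc n) (cpow w) y / of_nat (Suc n)) - w * cpow (w + 1) y"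

lemma newton_defect_rec:
  assumes "y > 0"
  shows "newton_defect N w y = of_real y * newton_defect N (w + 1) y + adiff N (cpow (w + 1)) y"
proof (induction N)
  case 0
  have "of_real y * cpow (w + 1 + 1) y = cpow (w + 1) y"
    using assms by (rule of_real_mult_cpow)
  thus ?case by (simp add: newton_defect_def algebra_simps)
next
  case (Suc N)
  define A B where "A = adiff N (cpow (w + 1)) y" and "B = adiff (Suc N) (cpow (w + 1)) y"
  define m where "m = (of_nat (Suc N) :: complex)"
  have m: "m \<noteq> 0" by (simp add: m_def del: of_nat_Suc)
  have "newton_defect (Suc N) w y = newton_defect N w y + adiff (Suc N) (cpow w) y / m"
    by (simp add: newton_defect_def m_def)
  also have "adiff (Suc N) (cpow w) y = (of_real y + m) * B - m * A"
    unfolding adiff_cpow_rec[OF assms, of _ w] A_def B_def m_def ..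
  also have "newton_defect N w y + ((of_real y + m) * B - m * A) / m = newton_defect N w y + (of_real y * (B / m) + B - A)"
    using m by (simp add: field_simps)
  also have "\<dots> = of_real y * newton_defect N (w + 1) y + of_real y * (B / m) + B"
    by (simp add: Suc A_def)
  also have "of_real y * newton_defect N (w + 1) y = of_real y * newton_defect (Suc N) (w + 1) y - of_real y * (B / m)"
    by (simp add: newton_defect_def algebra_simps B_def m_def)
  finally show ?case by (simp add: B_def)
qed

lemma newton_defect_has_vector_derivative:
  assumes "y > 0"
  shows "(newton_defect N w has_vector_derivative - w * newton_defect N (w + 1) y) (at y)"
proof -
  have "(adiff n (cpow w) has_vector_derivative adiff n (\<lambda>x. - w * cpow (w + 1) x) y) (at y)" for n
    by (rule adiff_has_vector_derivative) (rule cpow_has_vector_derivative, use assms in simp)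
  hence "(adiff n (cpow w) has_vector_derivative - w * adiff n (cpow (w + 1)) y) (at y)" for n
    by (simp only: adiff_cmult)
  note this[derivative_intros]
  have "((\<lambda>y. (\<Sum>n<N. adiff (Suc n) (cpow w) y / of_nat (Suc n)) - w * cpow (w + 1) y) has_vector_derivative
     (\<Sum>n<N. (- w * adiff (Suc n) (cpow (w + 1)) y) / of_nat (Suc n)) - w * (- (w + 1) * cpow (w + 1 + 1) y)) (at y)"
    by (intro derivative_intros cpow_has_vector_derivative assms has_vector_derivative_divide has_vector_derivative_mult_right)
  thus ?thesis
    by (simp add: newton_defect_def[abs_def] sum_distrib_left algebra_simps sum_negf del: adiff.simps)
qed

lemma norm_adiff_Suc_cpow_le:
  assumes C: "0 \<le> C" "C < y" and v: "norm v \<le> C" "Re v \<ge> - 1" and t: "t \<ge> y"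
  shows "norm (adiff (Suc n) (cpow v) t) \<le> C * (rising_quot n C y * t powr (- Re v - 1))"
proof (rule norm_adiff_Suc_cpow_le_of_bound)
  fix x assume x: "x \<ge> t"
  have "norm (adiff n (cpow (v + 1)) x) \<le> rising_quot n C y * x powr (- Re v - 1)"
    by (rule norm_adiff_cpow_le) (use C v x t in auto)
  also have "\<dots> \<le> rising_quot n C y * t powr (- Re v - 1)"
    using x t C v by (intro mult_left_mono powr_mono2' rising_quot_nonneg C) auto
  finally show "norm (adiff n (cpow (v + 1)) x) \<le> rising_quot n C y * t powr (- Re v - 1)" .
qed (use C t v in auto)

text \<open>
  The derivative of the defect at exponent \<open>v\<close> is \<open>- v\<close> times the defect at \<open>v + 1\<close>, and by
  \<open>newton_defect_rec\<close> \<open>t\<close> times the latter differs from the former by a single difference. Hence the product of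
  \<open>t powr v\<close> and the defect has a derivative of norm at most
  \<open>C * rising_quot N C y / t\<^sup>2\<close>. This product vanishes at infinity, so integration from \<open>y\<close> to
  infinity bounds it.
\<close>

lemma norm_newton_defect_le:
  assumes C: "0 \<le> C" "C < y" and v: "norm v \<le> C" "Re v \<ge> - 1"
  shows "norm (newton_defect N v y) \<le> C * rising_quot N C y / y * y powr (- Re v)"
proof -
  define \<phi> where "\<phi> = (\<lambda>t. cpow (- v) t * newton_defect N v t)"
  have y: "y > 0" using C by simp
  have bound: "norm (\<phi> T - \<phi> y) \<le> C * rising_quot N C y / y" if T: "T > y" for T
  proof -
    have deriv: "(\<phi> has_vector_derivative v * cpow (- v + 1) t * adiff N (cpow (v + 1)) t) (at t)"
      if "t > 0" for t
    proof -
      have "(\<phi> has_vector_derivative (cpow (- v) t * (- v * newton_defect N (v + 1) t) + (- (- v) * cpow (- v + 1) t) * newton_defect N v t)) (at t)"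
        unfolding \<phi>_def by (intro has_vector_derivative_mult cpow_has_vector_derivative newton_defect_has_vector_derivative that)
      also have "cpow (- v) t = of_real t * cpow (- v + 1) t"
        using of_real_mult_cpow[OF that, of "- v"] by simp
      also have "of_real t * cpow (- v + 1) t * (- v * newton_defect N (v + 1) t) + (- (- v) * cpow (- v + 1) t) * newton_defect N v t =
        v * cpow (- v + 1) t * (newton_defect N v t - of_real t * newton_defect N (v + 1) t)"
        by (simp add: algebra_simps)
      also have "newton_defect N v t - of_real t * newton_defect N (v + 1) t = adiff N (cpow (v + 1)) t"
        using newton_defect_rec[OF that, of N v] by simp
      finally show ?thesis .
    qed
    have "norm (\<phi> T - \<phi> y) \<le> - (C * rising_quot N C y / T) - - (C * rising_quot N C y / y)"
    proof (rule differentiable_bound_general[OF T, where \<phi>' = "\<lambda>t. C * rising_quot N C y / t\<^sup>2"])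
      show "continuous_on {y..T} \<phi>"
        using y by (intro continuous_at_imp_continuous_on ballI)
          (auto intro!: has_vector_derivative_continuous deriv)
      show "continuous_on {y..T} (\<lambda>t. - (C * rising_quot N C y / t))"
        using y by (intro continuous_intros) auto
      fix t assume t: "y < t" "t < T"
      show "(\<phi> has_vector_derivative v * cpow (- v + 1) t * adiff N (cpow (v + 1)) t) (at t)"
        using t y by (intro deriv) auto
      show "((\<lambda>t. - (C * rising_quot N C y / t)) has_vector_derivative C * rising_quot N C y / t\<^sup>2) (at t)"
        unfolding has_real_derivative_iff_has_vector_derivative[symmetric]
        using t y by (auto intro!: derivative_eq_intros simp: power2_eq_square)
      have "norm (v * cpow (- v + 1) t * adiff N (cpow (v + 1)) t) \<le> C * t powr (Re v - 1) * (rising_quot N C y * t powr (- Re v - 1))"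
        unfolding norm_mult using t y C v
        by (intro mult_mono norm_adiff_cpow_le mult_nonneg_nonneg) (auto simp: norm_cpow)
      also have "\<dots> = C * rising_quot N C y * (t powr (Re v - 1) * t powr (- Re v - 1))"
        by simp
      also have "t powr (Re v - 1) * t powr (- Re v - 1) = 1 / t\<^sup>2"
        using t y by (simp add: powr_add[symmetric] powr_minus powr_numeral field_simps)
      finally show "norm (v * cpow (- v + 1) t * adiff N (cpow (v + 1)) t) \<le> C * rising_quot N C y / t\<^sup>2"
        by simp
    qed
    also have "\<dots> \<le> C * rising_quot N C y / y"
      using T y C rising_quot_nonneg[OF C, of N] by auto
    finally show ?thesis .
  qed
  have "(\<phi> \<longlongrightarrow> 0) at_top"
  proof (rule Lim_null_comparison)
    define M where "M = (\<Sum>n<N. C * rising_quot n C y / real (Suc n)) + C"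
    show "\<forall>\<^sub>F t in at_top. norm (\<phi> t) \<le> M / t"
      using eventually_gt_at_top[of y]
    proof eventually_elim
      case (elim t)
      have "norm (newton_defect N v t) \<le> norm (\<Sum>n<N. adiff (Suc n) (cpow v) t / of_nat (Suc n)) + norm (v * cpow (v + 1) t)"
        unfolding newton_defect_def by (rule norm_triangle_ineq4)
      also have "\<dots> \<le> (\<Sum>n<N. C * rising_quot n C y / real (Suc n) * t powr (- Re v - 1)) + C * t powr (- Re v - 1)"
      proof (intro add_mono sum_norm_le)
        show "norm (v * cpow (v + 1) t) \<le> C * t powr (- Re v - 1)"
          using v elim y by (auto simp: norm_mult norm_cpow intro!: mult_right_mono)
        fix n
        have "norm (adiff (Suc n) (cpow v) t) \<le> C * (rising_quot n C y * t powr (- Re v - 1))"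
          using elim by (intro norm_adiff_Suc_cpow_le C v) auto
        hence "norm (adiff (Suc n) (cpow v) t) / real (Suc n) \<le> C * (rising_quot n C y * t powr (- Re v - 1)) / real (Suc n)"
          by (intro divide_right_mono) auto
        thus "norm (adiff (Suc n) (cpow v) t / of_nat (Suc n)) \<le> C * rising_quot n C y / real (Suc n) * t powr (- Re v - 1)"
          by (simp add: norm_divide mult_ac del: adiff.simps of_nat_Suc)
      qed
      also have "\<dots> = M * t powr (- Re v - 1)"
        by (simp add: M_def sum_distrib_right distrib_right)
      finally have "norm (\<phi> t) \<le> t powr Re v * (M * t powr (- Re v - 1))"
        using elim y by (auto simp: \<phi>_def norm_mult norm_cpow intro!: mult_left_mono)
      also have "\<dots> = M * (t powr Re v * t powr (- Re v - 1))"
        by simp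
      also have "t powr Re v * t powr (- Re v - 1) = 1 / t"
        using elim y by (simp add: powr_add[symmetric] powr_minus field_simps)
      finally show ?case by simp
    qed
    show "((\<lambda>t. M / t) \<longlongrightarrow> 0) at_top"
      by (intro tendsto_divide_0[OF tendsto_const] filterlim_at_top_imp_at_infinity filterlim_ident)
  qed
  hence "((\<lambda>T. norm (\<phi> T - \<phi> y)) \<longlongrightarrow> norm (0 - \<phi> y)) at_top"
    by (intro tendsto_intros)
  moreover have "\<forall>\<^sub>F T in at_top. norm (\<phi> T - \<phi> y) \<le> C * rising_quot N C y / y"
    by (rule eventually_mono[OF eventually_gt_at_top[of y] bound])
  ultimately have "norm (0 - \<phi> y) \<le> C * rising_quot N C y / y"
    by (rule tendsto_upperbound) simp
  hence *: "norm (\<phi> y) \<le> C * rising_quot N C y / y" by simp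
  have "newton_defect N v y = cpow v y * \<phi> y"
    using cpow_mult[of v y "- v"] by (simp add: \<phi>_def mult.assoc[symmetric]) (simp add: cpow_def)
  hence "norm (newton_defect N v y) = norm (\<phi> y) * y powr (- Re v)"
    using y by (simp add: norm_mult norm_cpow)
  also have "\<dots> \<le> C * rising_quot N C y / y * y powr (- Re v)"
    by (intro mult_right_mono *) auto
  finally show ?thesis .
qed

lemma adiff_cpow_tendsto_0:
  assumes C: "0 \<le> C" "C < y" and w: "norm (w + of_nat j) \<le> C" "Re (w + of_nat j) \<ge> - 1"
  shows "(\<lambda>n. adiff n (cpow w) y) \<longlonglongrightarrow> 0"
proof -
  obtain K where K: "K \<ge> 0" "\<And>n w. norm (w + of_nat j) \<le> C \<Longrightarrow> Re (w + of_nat j) \<ge> - 1 \<Longrightarrow>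
     norm (adiff (n + Suc j) (cpow w) y) \<le> K * rising_quot n C y"
    using norm_adiff_cpow_uniform[OF C] by metis
  have "(\<lambda>n. adiff (n + Suc j) (cpow w) y) \<longlonglongrightarrow> 0"
    by (rule Lim_null_comparison[where g = "\<lambda>n. K * rising_quot n C y"])
       (intro always_eventually allI K w, intro tendsto_mult_right_zero rising_quot_tendsto_0 C)
  thus ?thesis by (rule LIMSEQ_offset)
qed

lemma newton_defect_tendsto_0:
  assumes "norm (w + of_nat j) < y" "Re (w + of_nat j) \<ge> - 1"
  shows "(\<lambda>N. newton_defect N w y) \<longlonglongrightarrow> 0"
  using assms
proof (induction j arbitrary: w)
  case 0
  define C where "C = norm w"
  have C: "0 \<le> C" "C < y" using 0 by (auto simp: C_def)
  show ?case
  proof (rule Lim_null_comparison)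
    show "\<forall>\<^sub>F N in sequentially. norm (newton_defect N w y) \<le> C * rising_quot N C y / y * y powr (- Re w)"
      by (intro always_eventually allI norm_newton_defect_le C) (use 0 in \<open>auto simp: C_def\<close>)
    have "(\<lambda>N. C * rising_quot N C y / y * y powr (- Re w)) \<longlonglongrightarrow> C * 0 / y * y powr (- Re w)"
      by (intro tendsto_intros rising_quot_tendsto_0 C) (use C in auto)
    thus "(\<lambda>N. C * rising_quot N C y / y * y powr (- Re w)) \<longlonglongrightarrow> 0" by simp
  qed
next
  case (Suc j)
  have "(\<lambda>N. newton_defect N (w + 1) y) \<longlonglongrightarrow> 0"
    by (rule Suc.IH) (use Suc.prems in \<open>auto simp: add_ac\<close>)
  moreover have "(\<lambda>N. adiff N (cpow (w + 1)) y) \<longlonglongrightarrow> 0"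
    by (rule adiff_cpow_tendsto_0[where j = j and C = "norm (w + 1 + of_nat j)"]) (use Suc.prems in \<open>auto simp: add_ac\<close>)
  ultimately have lim: "(\<lambda>N. of_real y * newton_defect N (w + 1) y + adiff N (cpow (w + 1)) y) \<longlonglongrightarrow> of_real y * 0 + 0"
    by (intro tendsto_add tendsto_mult_left)
  have "y > 0"
    using Suc.prems(1) norm_ge_zero[of "w + of_nat (Suc j)"] by linarith
  hence "(\<lambda>N. newton_defect N w y) = (\<lambda>N. of_real y * newton_defect N (w + 1) y + adiff N (cpow (w + 1)) y)"
    by (intro ext newton_defect_rec)
  with lim show ?case by simp
qed

text \<open>
  The difference equation \<open>(log (1 + \<Delta>) / \<Delta>) \<Delta> = D\<close> for powers: it is the convergence of the
  Newton series of the derivative.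
\<close>

lemma hasse_shift:
  assumes w: "norm (w + of_nat j) < y" "Re (w + of_nat j) > - 1"
  shows "hasse w (y + 1) = hasse w y - w * cpow (w + 1) y"
proof -
  have "(\<lambda>N. newton_defect N w y + w * cpow (w + 1) y) \<longlonglongrightarrow> 0 + w * cpow (w + 1) y"
    by (intro tendsto_intros newton_defect_tendsto_0[where j = j]) (use w in auto)
  hence 1: "(\<lambda>n. adiff (Suc n) (cpow w) y / of_nat (Suc n)) sums (w * cpow (w + 1) y)"
    by (simp add: sums_def newton_defect_def del: adiff.simps)
  have "(\<lambda>n. adiff n (cpow w) y / of_nat (Suc n)) sums hasse w y"
    by (rule hasse_sums) (use w in auto)
  from sums_diff[OF this 1]
  have "(\<lambda>n. adiff n (cpow w) (y + 1) / of_nat (Suc n)) sums (hasse w y - w * cpow (w + 1) y)"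
    by (simp add: diff_divide_distrib[symmetric] del: of_nat_Suc)
  moreover have "(\<lambda>n. adiff n (cpow w) (y + 1) / of_nat (Suc n)) sums hasse w (y + 1)"
    by (rule hasse_sums) (use w in auto)
  ultimately show ?thesis by (rule sums_unique2[symmetric])
qed

section \<open>Continuation of the zeta function\<close>

text \<open>
  For \<open>Re w > 0\<close> the series decays along translates of \<open>y\<close>, so \<open>hasse_shift\<close> expands it into
  the Dirichlet series of the Hurwitz zeta function.
\<close>

lemma hasse_tendsto_0:
  assumes w: "Re w > 0" and y: "norm w < y"
  shows "(\<lambda>n. hasse w (y + real n)) \<longlonglongrightarrow> 0"
proof -
  define C where "C = norm w"
  have C: "0 \<le> C" "C < y" using y by (auto simp: C_def)
  have v: "norm w \<le> C" "Re w \<ge> - 1" using w by (auto simp: C_def)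
  define M where "M = (\<Sum>n. C * (rising_quot n C y / real (Suc n)))"
  have sm: "summable (\<lambda>n. C * (rising_quot n C y / real (Suc n)))"
    by (intro summable_mult rising_quot_summable C)
  have bound: "norm (hasse w t) \<le> t powr (- Re w) + M * t powr (- Re w - 1)" if t: "t \<ge> y" for t
  proof -
    have "(\<lambda>n. adiff n (cpow w) t / of_nat (Suc n)) sums hasse w t"
      by (rule hasse_sums[where j = 0]) (use w y t in auto)
    hence "hasse w t = adiff 0 (cpow w) t / of_nat (Suc 0) + (\<Sum>n. adiff (Suc n) (cpow w) t / of_nat (Suc (Suc n)))"
      by (subst hasse_def, subst suminf_split_head) (auto simp: sums_iff)
    also have "norm \<dots> \<le> t powr (- Re w) + (\<Sum>n. C * (rising_quot n C y / real (Suc n)) * t powr (- Re w - 1))"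
    proof (rule norm_triangle_mono)
      show "norm (adiff 0 (cpow w) t / of_nat (Suc 0)) \<le> t powr (- Re w)"
        using t C by (simp add: norm_cpow)
      show "norm (\<Sum>n. adiff (Suc n) (cpow w) t / of_nat (Suc (Suc n))) \<le> (\<Sum>n. C * (rising_quot n C y / real (Suc n)) * t powr (- Re w - 1))"
      proof (rule norm_suminf_le)
        show "summable (\<lambda>n. C * (rising_quot n C y / real (Suc n)) * t powr (- Re w - 1))"
          by (intro summable_mult2 sm)
        fix n
        have "norm (adiff (Suc n) (cpow w) t) \<le> C * (rising_quot n C y * t powr (- Re w - 1))"
          by (rule norm_adiff_Suc_cpow_le) (use C v t in auto)
        hence "norm (adiff (Suc n) (cpow w) t) / real (Suc (Suc n)) \<le> C * (rising_quot n C y * t powr (- Re w - 1)) / real (Suc (Suc n))"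
          by (intro divide_right_mono) auto
        also have "\<dots> \<le> C * (rising_quot n C y * t powr (- Re w - 1)) / real (Suc n)"
          using C rising_quot_nonneg[OF C, of n] by (intro divide_left_mono) auto
        finally show "norm (adiff (Suc n) (cpow w) t / of_nat (Suc (Suc n))) \<le> C * (rising_quot n C y / real (Suc n)) * t powr (- Re w - 1)"
          by (simp only: norm_divide norm_of_nat) (simp add: mult_ac)
      qed
    qed
    also have "(\<Sum>n. C * (rising_quot n C y / real (Suc n)) * t powr (- Re w - 1)) = M * t powr (- Re w - 1)"
      unfolding M_def by (rule suminf_mult2[OF sm, symmetric])
    finally show ?thesis .
  qed
  show ?thesis
  proof (rule Lim_null_comparison)
    show "\<forall>\<^sub>F n in sequentially. norm (hasse w (y + real n)) \<le> (y + real n) powr (- Re w) + M * (y + real n) powr (- Re w - 1)"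
      by (intro always_eventually allI bound) auto
    have lim: "filterlim (\<lambda>n. y + real n) at_top sequentially"
      by (intro filterlim_tendsto_add_at_top[OF tendsto_const] filterlim_real_sequentially)
    have "(\<lambda>n. (y + real n) powr (- Re w) + M * (y + real n) powr (- Re w - 1)) \<longlonglongrightarrow> 0 + M * 0"
      using w by (intro tendsto_add tendsto_mult tendsto_const tendsto_neg_powr lim) auto
    thus "(\<lambda>n. (y + real n) powr (- Re w) + M * (y + real n) powr (- Re w - 1)) \<longlonglongrightarrow> 0" by simp
  qed
qed

text \<open>
  The zeta function as the first \<open>Y\<close> terms of its Dirichlet series plus Hasse's series at
  \<open>Y + 1\<close>. The estimates above give convergence of the latter only when \<open>Y\<close> is large compared
  with \<open>s\<close>; by \<open>zeta_split_Suc\<close> the value does not depend on \<open>Y\<close> in that range.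
\<close>

definition zeta_split :: "nat \<Rightarrow> complex \<Rightarrow> complex" where
  "zeta_split Y s = (\<Sum>k<Y. cpow s (real (Suc k))) + hasse (s - 1) (real (Suc Y)) / (s - 1)"

lemma zeta_split_Suc:
  assumes "s \<noteq> 1" "norm (s - 1 + of_nat j) < real (Suc Y)" "Re (s - 1 + of_nat j) > - 1"
  shows "zeta_split (Suc Y) s = zeta_split Y s"
  using hasse_shift[OF assms(2,3)] assms(1) by (simp add: zeta_split_def diff_divide_distrib add_ac)

lemma zeta_split_eq:
  assumes "s \<noteq> 1" "norm (s - 1) \<le> real R" "Y \<ge> 2 * R"
  shows "zeta_split Y s = zeta_split (2 * R) s"
  using assms(3)
proof (induction Y rule: dec_induct)
  case (step Y)
  have "norm (s - 1 + of_nat R) \<le> real R + real R"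
    by (rule norm_triangle_mono) (use assms in auto)
  hence 1: "norm (s - 1 + of_nat R) < real (Suc Y)"
    using step by simp
  \<comment> \<open>The shift by \<open>R\<close> makes the real part nonnegative and keeps the norm at most \<open>2 * R\<close>.\<close>
  have "\<bar>Re (s - 1)\<bar> \<le> real R"
    using abs_Re_le_cmod assms(2) by (rule order_trans)
  hence "Re (s - 1 + of_nat R) > - 1" by auto
  from zeta_split_Suc[OF assms(1) 1 this] step show ?case by simp
qed simp

text \<open>
  The continuation to the punctured plane. The cut-off grows with \<open>s\<close>; it is locally replaceable
  by a constant one.
\<close>

definition zeta_ext :: "complex \<Rightarrow> complex" where
  "zeta_ext s = zeta_split (2 * nat \<lceil>norm (s - 1)\<rceil>) s"

lemma zeta_ext_eq:
  assumes "s \<noteq> 1" "norm (s - 1) \<le> real R" "Y \<ge> 2 * R"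
  shows "zeta_ext s = zeta_split Y s"
proof -
  have "nat \<lceil>norm (s - 1)\<rceil> \<le> R"
    using assms(2) by linarith
  hence "2 * nat \<lceil>norm (s - 1)\<rceil> \<le> Y" using assms(3) by linarith
  hence "zeta_split Y s = zeta_split (2 * nat \<lceil>norm (s - 1)\<rceil>) s"
    by (intro zeta_split_eq assms of_nat_ceiling)
  thus ?thesis by (simp add: zeta_ext_def)
qed

lemma hasse_holomorphic: "(\<lambda>w. hasse w (real (2 * R + 1))) holomorphic_on ball 0 (real R)"
proof -
  have "(\<lambda>w. hasse w (real (2 * R + 1))) field_differentiable at w" if w: "w \<in> ball 0 (real R)" for w
  proof -
    have "norm (v + of_nat R) \<le> real (2 * R)" "Re (v + of_nat R) \<ge> - 1" if v: "v \<in> ball 0 (real R)" for v :: complex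
    proof -
      have "norm (v + of_nat R) \<le> real R + real R"
        by (rule norm_triangle_mono) (use v in auto)
      thus "norm (v + of_nat R) \<le> real (2 * R)" by simp
      have "\<bar>Re v\<bar> \<le> real R"
        by (rule order_trans[OF abs_Re_le_cmod]) (use v in auto)
      thus "Re (v + of_nat R) \<ge> - 1" by auto
    qed
    from hasse_has_derivative(3)[OF _ _ open_ball this w, where y = "real (2 * R + 1)"]
    show ?thesis by (auto simp: field_differentiable_def)
  qed
  thus ?thesis by (auto simp: holomorphic_on_def intro: field_differentiable_at_within)
qed

lemma is_zeta_continuation_zeta_ext: "is_zeta_continuation zeta_ext"
  unfolding is_zeta_continuation_def
proof safe
  show "zeta_ext holomorphic_on - {1}"
  proof (rule holomorphic_onI)
    fix s0 :: complex assume s0: "s0 \<in> - {1}"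
    obtain R :: nat where R: "norm (s0 - 1) < real R"
      using reals_Archimedean2 by blast
    define T where "T = ball 1 (real R) - {1 :: complex}"
    have "open T" by (auto simp: T_def intro!: open_Diff)
    have "s0 \<in> T" using s0 R by (auto simp: T_def dist_norm norm_minus_commute)
    have "(\<lambda>s. hasse (s - 1) (real (2 * R + 1))) holomorphic_on T"
      by (rule holomorphic_on_compose_gen[OF _ hasse_holomorphic, where f = "\<lambda>s. s - 1", unfolded o_def])
         (auto simp: T_def dist_norm norm_minus_commute intro!: holomorphic_intros)
    hence "zeta_split (2 * R) holomorphic_on T"
      unfolding zeta_split_def[abs_def] cpow_def
      by (intro holomorphic_intros) (auto simp: T_def)
    hence "zeta_ext holomorphic_on T"
      by (rule holomorphic_transform) 
        (rule zeta_ext_eq[symmetric, where R = R], auto simp: T_def dist_norm norm_minus_commute)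
    thus "zeta_ext field_differentiable at s0 within - {1}"
      using \<open>open T\<close> \<open>s0 \<in> T\<close> by (metis holomorphic_on_imp_differentiable_at field_differentiable_at_within)
  qed
next
  fix s :: complex assume s: "Re s > 1"
  hence s1: "s \<noteq> 1" by auto
  obtain R :: nat where R: "norm (s - 1) < real R"
    using reals_Archimedean2 by blast
  have "(\<lambda>n. hasse (s - 1) (real R + real n)) \<longlonglongrightarrow> 0"
    by (rule hasse_tendsto_0) (use s R in auto)
  hence "(\<lambda>n. hasse (s - 1) (real n)) \<longlonglongrightarrow> 0"
    by (subst (asm) add.commute) (rule LIMSEQ_offset[where k = R], simp)
  hence "(\<lambda>n. hasse (s - 1) (real (Suc n))) \<longlonglongrightarrow> 0"
    by (rule LIMSEQ_Suc)
  hence "(\<lambda>Y. zeta_ext s - hasse (s - 1) (real (Suc Y)) / (s - 1)) \<longlonglongrightarrow> zeta_ext s - 0 / (s - 1)"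
    using s1 by (intro tendsto_intros) auto
  hence "(\<lambda>Y. zeta_ext s - hasse (s - 1) (real (Suc Y)) / (s - 1)) \<longlonglongrightarrow> zeta_ext s"
    by simp
  moreover have "\<forall>\<^sub>F Y in sequentially. zeta_ext s - hasse (s - 1) (real (Suc Y)) / (s - 1) = (\<Sum>k<Y. cpow s (real (Suc k)))"
    using eventually_ge_at_top[of "2 * R"]
    by eventually_elim (use zeta_ext_eq[OF s1, of R] R in \<open>simp add: zeta_split_def\<close>)
  ultimately have "(\<lambda>k. cpow s (real (Suc k))) sums zeta_ext s"
    unfolding sums_def by (rule Lim_transform_eventually)
  thus "(\<lambda>n. 1 / of_nat (Suc n) powr s) sums zeta_ext s"
    by (simp add: cpow_powr powr_minus field_simps)
qed

text \<open>
  Near \<open>- 1\<close> no terms need to be split off: \<open>s - 1\<close> is close to \<open>- 2\<close>, so that the estimates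
  with \<open>j = 2\<close> apply at every \<open>y \<ge> 1\<close>.
\<close>

lemma zeta_eq_hasse:
  assumes "norm (s + 1) < 1 / 2"
  shows "zeta s = hasse (s - 1) 1 / (s - 1)"
proof -
  have s1: "s \<noteq> 1" using assms by auto
  have "is_zeta_continuation zeta"
    unfolding zeta_def by (rule someI[of is_zeta_continuation, OF is_zeta_continuation_zeta_ext])
  hence "zeta s = zeta_ext s"
    by (rule is_zeta_continuation_unique[OF _ is_zeta_continuation_zeta_ext s1])
  also obtain Y where "zeta_ext s = zeta_split Y s" by (simp add: zeta_ext_def)
  also have "zeta_split Y s = zeta_split 0 s"
  proof (induction Y)
    case (Suc Y)
    have eq: "s - 1 + of_nat 2 = s + 1" by simp
    have "\<bar>Re (s + 1)\<bar> < 1 / 2"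
      using abs_Re_le_cmod assms by (rule order_le_less_trans)
    hence "Re (s - 1 + of_nat 2) > - 1" unfolding eq by linarith
    moreover have "norm (s - 1 + of_nat 2) < real (Suc Y)"
      unfolding eq using assms by simp
    ultimately show ?case using zeta_split_Suc[OF s1] Suc by metis
  qed simp
  finally show ?thesis by (simp add: zeta_split_def)
qed

section \<open>The derivative of the zeta function at minus one\<close>

text \<open>
  The function \<open>x \<mapsto> x\<^sup>2 ln x\<close>, which is minus the derivative of \<open>cpow w x\<close> with respect to \<open>w\<close>
  at \<open>w = - 2\<close>.
\<close>

definition sq_ln :: "real \<Rightarrow> complex" where
  "sq_ln x = of_real (x\<^sup>2 * ln x)"

text \<open>
  The logarithmic series of the theorem, with complex values; \<open>log_series\<close> below is its real form.
\<close>

definition log_series_c :: "real \<Rightarrow> complex" where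
  "log_series_c y = (\<Sum>n. adiff n sq_ln y / of_nat (Suc n))"

lemma cpow_minus_two: "x > 0 \<Longrightarrow> cpow (- 2) x = of_real (x\<^sup>2)"
  using cpow_mult[of "-1" x "-1"] by (simp add: cpow_minus_one power2_eq_square)

text \<open>
  The comparison test for holomorphic series yields the convergence of the differentiated series
  together with the derivative, at every \<open>y > 0\<close>.
\<close>

lemma hasse_has_derivative_minus_two:
  assumes y: "y > 0"
  shows "summable (\<lambda>n. adiff n sq_ln y / of_nat (Suc n))"
    and "((\<lambda>w. hasse w y) has_field_derivative - log_series_c y) (at (- 2))"
proof -
  define C where "C = min (1 / 2) (y / 2)"
  have C: "0 \<le> C" "C < y" "C > 0" "C \<le> 1 / 2" using y by (auto simp: C_def)
  have S: "norm (w + of_nat 2) \<le> C" "Re (w + of_nat 2) \<ge> - 1" if w: "w \<in> ball (- 2) C" for w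
  proof -
    have "dist (- 2) w = norm (w + 2)" by (simp add: dist_norm norm_minus_commute[of "- 2"])
    thus *: "norm (w + of_nat 2) \<le> C" using w by simp
    have "\<bar>Re (w + of_nat 2)\<bar> \<le> C" by (rule order_trans[OF abs_Re_le_cmod *])
    thus "Re (w + of_nat 2) \<ge> - 1" using C by linarith
  qed
  have m: "- 2 \<in> ball (- 2 :: complex) C" using C by simp
  have eq: "adiff n (\<lambda>x. - of_real (ln x) * cpow (- 2) x) y / of_nat (Suc n) = - (adiff n sq_ln y / of_nat (Suc n))" for n
  proof -
    have "adiff n (\<lambda>x. - of_real (ln x) * cpow (- 2) x) y = adiff n (\<lambda>x. (- 1) * sq_ln x) y"
      by (rule adiff_cong) (use y in \<open>simp add: cpow_minus_two sq_ln_def\<close>)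
    also have "\<dots> = - adiff n sq_ln y"
      by (subst adiff_cmult) simp
    finally show ?thesis by simp
  qed
  note * = hasse_has_derivative[OF C(1,2) open_ball S m, unfolded eq]
  show sm: "summable (\<lambda>n. adiff n sq_ln y / of_nat (Suc n))"
    using *(2) by (simp add: summable_minus_iff)
  show "((\<lambda>w. hasse w y) has_field_derivative - log_series_c y) (at (- 2))"
    using *(3) by (simp only: suminf_minus[OF sm] log_series_c_def)
qed

lemma log_series_c_shift:
  assumes y: "y > 0"
  shows "log_series_c (y + 1) = log_series_c y + of_real (y + 2 * y * ln y)"
proof -
  define r where "r = min 1 y"
  have r: "r > 0" "r \<le> 1" "r \<le> y" using y by (auto simp: r_def)
  have 1: "((\<lambda>w. hasse w (y + 1)) has_field_derivative - log_series_c (y + 1)) (at (- 2))"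
    by (rule hasse_has_derivative_minus_two) (use y in auto)
  have "((\<lambda>w. w * cpow (w + 1) y) has_field_derivative (cpow (- 1) y + (- 2) * (- of_real (ln y) * cpow (- 1) y))) (at (- 2))"
    unfolding cpow_def by (auto intro!: derivative_eq_intros simp: algebra_simps)
  hence "((\<lambda>w. hasse w y - w * cpow (w + 1) y) has_field_derivative
      (- log_series_c y - (cpow (- 1) y + (- 2) * (- of_real (ln y) * cpow (- 1) y)))) (at (- 2))"
    by (intro DERIV_diff hasse_has_derivative_minus_two y)
  hence "((\<lambda>w. hasse w (y + 1)) has_field_derivative
      (- log_series_c y - (cpow (- 1) y + (- 2) * (- of_real (ln y) * cpow (- 1) y)))) (at (- 2))"
  proof (rule has_field_derivative_transform_within_open)
    fix w :: complex assume w: "w \<in> ball (- 2) r"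
    have "norm (w + 2) < r" using w by (simp add: dist_norm norm_minus_commute[of "- 2"])
    moreover have "\<bar>Re (w + 2)\<bar> \<le> norm (w + 2)" by (rule abs_Re_le_cmod)
    ultimately have "norm (w + of_nat 2) < y" "Re (w + of_nat 2) > - 1" using r by auto
    thus "hasse w y - w * cpow (w + 1) y = hasse w (y + 1)"
      by (rule hasse_shift[symmetric])
  qed (use r in auto)
  from DERIV_unique[OF 1 this]
  have "log_series_c (y + 1) = log_series_c y + (cpow (- 1) y + (- 2) * (- of_real (ln y) * cpow (- 1) y))"
    by (simp add: algebra_simps)
  thus ?thesis using y by (simp add: cpow_minus_one)
qed

lemma hasse_minus_two_one: "hasse (- 2) 1 = 1 / 6"
proof -
  have eq: "cpow (- 2) x = of_real x ^ 2" if "x > 0" for x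
    using cpow_minus_two[OF that] by simp
  have "adiff (n + 3) (cpow (- 2)) y = 0" if "y > 0" for n y
    using that
  proof (induction n arbitrary: y)
    case 0
    thus ?case by (simp add: numeral_3_eq_3 eq power2_eq_square algebra_simps)
  next
    case (Suc n)
    have "adiff (Suc (n + 3)) (cpow (- 2)) y = 0"
      using Suc.IH[of y] Suc.IH[of "y + 1"] Suc.prems by (simp only: adiff.simps) simp
    thus ?case by (simp only: add_Suc)
  qed
  hence "adiff n (cpow (- 2)) 1 / of_nat (Suc n) = 0" if "n \<notin> {..<3}" for n
    using that le_Suc_ex[of 3 n] by (auto simp: not_less add.commute)
  hence "hasse (- 2) 1 = (\<Sum>n<3. adiff n (cpow (- 2)) 1 / of_nat (Suc n))"
    unfolding hasse_def by (intro suminf_finite) auto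
  also have "\<dots> = 1 / 6"
    by (simp add: numeral_3_eq_3 eq power2_eq_square)
  finally show ?thesis .
qed

lemma deriv_zeta_minus_one: "deriv zeta (- 1) = log_series_c 1 / 2 - 1 / 24"
proof -
  have "((\<lambda>s. hasse (s - 1) 1) has_field_derivative (- log_series_c 1) * 1) (at (- 1))"
    by (rule DERIV_chain2[of "\<lambda>w. hasse w 1"])
      (auto intro!: derivative_eq_intros hasse_has_derivative_minus_two(2)[of 1, simplified])
  hence "((\<lambda>s. hasse (s - 1) 1 / (s - 1)) has_field_derivative
      ((- log_series_c 1) * (- 2) - hasse (- 2) 1) / ((- 2) * (- 2))) (at (- 1))"
    by (auto intro!: derivative_eq_intros)
  hence "(zeta has_field_derivative ((- log_series_c 1) * (- 2) - hasse (- 2) 1) / ((- 2) * (- 2))) (at (- 1))"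
  proof (rule has_field_derivative_transform_within_open)
    fix s :: complex assume "s \<in> ball (- 1) (1 / 2)"
    hence "norm (s + 1) < 1 / 2" by (simp add: dist_norm norm_minus_commute[of "- 1"])
    thus "hasse (s - 1) 1 / (s - 1) = zeta s" by (rule zeta_eq_hasse[symmetric])
  qed auto
  thus ?thesis by (simp add: DERIV_imp_deriv hasse_minus_two_one)
qed

section \<open>The logarithmic series\<close>

text \<open>
  The terms of the logarithmic series, and its sum.
\<close>

definition log_term :: "real \<Rightarrow> nat \<Rightarrow> real" where
  "log_term u n = 1 / real (n + 1) *
     (\<Sum>k=0..n. real (n choose k) * (- 1) ^ k * (u + real k)\<^sup>2 * ln (u + real k))"

lemma of_real_log_term: "complex_of_real (log_term u n) = adiff n sq_ln u / of_nat (Suc n)"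
  by (simp add: log_term_def adiff_binomial sq_ln_def atMost_atLeast0 mult_ac)

lemma summable_log_term: "u > 0 \<Longrightarrow> summable (log_term u)"
  using hasse_has_derivative_minus_two(1)[of u]
  by (simp only: of_real_log_term[symmetric] summable_complex_of_real)

definition log_series :: "real \<Rightarrow> real" where
  "log_series u = (\<Sum>n. log_term u n)"

lemma log_series_c_eq: "u > 0 \<Longrightarrow> log_series_c u = of_real (log_series u)"
  unfolding log_series_c_def log_series_def of_real_log_term[symmetric]
  by (rule suminf_of_real[symmetric]) (rule summable_log_term)

lemma log_series_shift: "u > 0 \<Longrightarrow> log_series (u + 1) = log_series u + (u + 2 * u * ln u)"
  using log_series_c_shift[of u] by (simp only: log_series_c_eq of_real_add[symmetric] of_real_eq_iff add_pos_pos zero_less_one)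

lemma log_series_shift_nat:
  assumes "u > 0"
  shows "log_series (u + real N) = log_series u + (\<Sum>j<N. 2 * (u + real j) * ln (u + real j) + (u + real j))"
proof (induction N)
  case (Suc N)
  have "log_series (u + real (Suc N)) = log_series ((u + real N) + 1)" by (simp add: add_ac)
  also have "\<dots> = log_series (u + real N) + (u + real N + 2 * (u + real N) * ln (u + real N))"
    by (rule log_series_shift) (use assms in auto)
  finally show ?case by (simp add: Suc)
qed simp

text \<open>
  The sum of the terms \<open>n = 0, 1, 2\<close> of the logarithmic series. The third derivative of
  \<open>x\<^sup>2 ln x\<close> is \<open>2 / x\<close>, so the later terms are controlled by differences of \<open>1 / x\<close>.
\<close>

definition log_head :: "real \<Rightarrow> real" where
  "log_head y = 11 / 6 * (y\<^sup>2 * ln y) - 7 / 6 * ((y + 1)\<^sup>2 * ln (y + 1)) + 1 / 3 * ((y + 2)\<^sup>2 * ln (y + 2))"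

lemma of_real_has_vector_derivative:
  "(f has_real_derivative f') (at x) \<Longrightarrow> ((\<lambda>x. complex_of_real (f x)) has_vector_derivative of_real f') (at x)"
  by (rule has_vector_derivative_of_real) (simp add: has_real_derivative_iff_has_vector_derivative)

lemma norm_adiff_sq_ln_le:
  assumes "y > 0"
  shows "norm (adiff (n + 3) sq_ln y) \<le> 2 * (rising_quot n 0 y / y)"
proof -
  define f1 f2 where "f1 = (\<lambda>x. complex_of_real (2 * x * ln x + x))"
    and "f2 = (\<lambda>x. complex_of_real (2 * ln x + 3))"
  have d0: "(sq_ln has_vector_derivative f1 x) (at x)" if "x \<ge> t" "t \<ge> y" for x t
    unfolding sq_ln_def[abs_def] f1_def using that assms
    by (intro of_real_has_vector_derivative)
       (auto intro!: derivative_eq_intros simp: power2_eq_square)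
  have d1: "(f1 has_vector_derivative f2 x) (at x)" if "x \<ge> t" "t \<ge> y" for x t
    unfolding f1_def f2_def using that assms
    by (intro of_real_has_vector_derivative) (auto intro!: derivative_eq_intros)
  have d2: "(f2 has_vector_derivative 2 * cpow 1 x) (at x)" if "x \<ge> t" "t \<ge> y" for x t
  proof -
    have "2 * cpow 1 x = complex_of_real (2 / x)"
      using of_real_mult_cpow[of x 0] that assms by (simp add: cpow_def[of 0] field_simps)
    thus ?thesis
      unfolding f2_def using that assms
      by (auto intro!: of_real_has_vector_derivative derivative_eq_intros)
  qed
  have b: "norm (adiff n (\<lambda>x. 2 * cpow 1 x) t) \<le> 2 * (rising_quot n 0 y / y)" if t: "t \<ge> y" for t
  proof -
    have "norm (adiff n (cpow (0 + 1)) t) \<le> rising_quot n 0 y * t powr (- Re 0 - 1)"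
      by (rule norm_adiff_cpow_le) (use assms t in auto)
    also have "\<dots> = rising_quot n 0 y / t"
      using t assms by (simp add: powr_minus divide_inverse)
    also have "\<dots> \<le> rising_quot n 0 y / y"
      using t assms rising_quot_nonneg[of 0 y n] by (intro divide_left_mono) auto
    finally show ?thesis by (subst adiff_cmult) (simp add: norm_mult)
  qed
  have "norm (adiff (Suc (Suc (Suc n))) sq_ln y) \<le> 2 * (rising_quot n 0 y / y)"
    by (intro norm_adiff_Suc_le[OF d0] norm_adiff_Suc_le[OF d1] norm_adiff_Suc_le[OF d2] b) auto
  thus ?thesis by (simp add: numeral_3_eq_3)
qed

lemma log_series_minus_head_le:
  assumes y: "y > 0"
  shows "\<bar>log_series y - log_head y\<bar> \<le> 2 * (1 + y) / y\<^sup>2"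
proof -
  have "(\<lambda>n. rising_quot n 0 y) \<longlonglongrightarrow> 0"
    by (rule rising_quot_tendsto_0) (use y in auto)
  hence s: "(\<lambda>n. rising_quot n 0 y / (real (Suc n) + y)) sums (1 / y)"
    using rising_quot_sums[of 0 y] y by (simp add: limI)
  have le: "\<bar>log_term y (n + 3)\<bar> \<le> 2 / y * (1 + y) * (rising_quot n 0 y / (real (Suc n) + y))" for n
  proof -
    have "\<bar>log_term y (n + 3)\<bar> = norm (complex_of_real (log_term y (n + 3)))" by simp
    also have "\<dots> = norm (adiff (n + 3) sq_ln y) / real (Suc (n + 3))"
      by (simp only: of_real_log_term norm_divide norm_of_nat)
    also have "\<dots> \<le> (2 * (rising_quot n 0 y / y)) / real (Suc (n + 3))"
      by (intro divide_right_mono norm_adiff_sq_ln_le y) auto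
    also have "\<dots> = 2 * (rising_quot n 0 y / y) * (1 / real (Suc (n + 3)))" by simp
    also have "\<dots> \<le> 2 * (rising_quot n 0 y / y) * ((1 + y) / (real (Suc n) + y))"
    proof (rule mult_left_mono)
      have "real (Suc n) + y \<le> (1 + y) * real (Suc (n + 3))"
        using y by (simp add: algebra_simps)
      thus "1 / real (Suc (n + 3)) \<le> (1 + y) / (real (Suc n) + y)"
        using y by (simp add: field_simps)
    qed (use y rising_quot_nonneg[of 0 y n] in auto)
    also have "\<dots> = 2 / y * (1 + y) * (rising_quot n 0 y / (real (Suc n) + y))"
      by (simp add: divide_inverse mult_ac)
    finally show ?thesis .
  qed
  have "log_series y = (\<Sum>n. log_term y (n + 3)) + (\<Sum>n<3. log_term y n)"
    unfolding log_series_def by (rule suminf_split_initial_segment[OF summable_log_term[OF y]])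
  also have "(\<Sum>n<3. log_term y n) = log_head y"
    by (simp add: log_term_def log_head_def numeral_3_eq_3 numeral_2_eq_2 field_simps)
  finally have "\<bar>log_series y - log_head y\<bar> = norm (\<Sum>n. log_term y (n + 3))" by simp
  also have "\<dots> \<le> (\<Sum>n. 2 / y * (1 + y) * (rising_quot n 0 y / (real (Suc n) + y)))"
    by (rule norm_suminf_le[OF _ summable_mult[OF sums_summable[OF s]]]) (simp only: real_norm_def le)
  also have "\<dots> = 2 / y * (1 + y) * (1 / y)"
    using sums_mult[OF s] by (rule sums_unique[symmetric])
  finally show ?thesis by (simp add: power2_eq_square)
qed

lemma log_series_minus_head_tendsto:
  assumes "u > 0"
  shows "(\<lambda>N. log_series (u + real (Suc N)) - log_head (u + real (Suc N))) \<longlonglongrightarrow> 0"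
proof (rule Lim_null_comparison)
  show "\<forall>\<^sub>F N in sequentially. norm (log_series (u + real (Suc N)) - log_head (u + real (Suc N)))
          \<le> 2 * (1 + (u + real (Suc N))) / (u + real (Suc N))\<^sup>2"
    using assms by (intro always_eventually allI) (simp only: real_norm_def, rule log_series_minus_head_le, simp)
  show "(\<lambda>N. 2 * (1 + (u + real (Suc N))) / (u + real (Suc N))\<^sup>2) \<longlonglongrightarrow> 0"
    by real_asymp
qed

section \<open>Stirling's formula\<close>

text \<open>
  The logarithm of \<open>n!\<close> minus the leading part of Stirling's formula. The limit exists because the increments
  are \<open>O(1 / n\<^sup>2)\<close>, and the Wallis product identifies it.
\<close>

definition stirling_seq :: "nat \<Rightarrow> real" where
  "stirling_seq n = ln (fact n) - (real n + 1 / 2) * ln (real n) + real n"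

lemma convergent_stirling_seq: "convergent stirling_seq"
proof -
  have "summable (\<lambda>n. stirling_seq (Suc (Suc n)) - stirling_seq (Suc n))"
  proof (rule summable_comparison_test_bigo)
    show "summable (\<lambda>n. norm (1 / real n ^ 2))"
      using inverse_power_summable[of 2, where 'a = real] by (simp add: divide_inverse)
    have "(\<lambda>n. stirling_seq (Suc (Suc n)) - stirling_seq (Suc n)) =
       (\<lambda>n. ln (real n + 2) - (real n + 5 / 2) * ln (real n + 2) + (real n + 3 / 2) * ln (real n + 1) + 1)"
    proof
      fix n
      have "ln (fact (Suc (Suc n))) = ln (real n + 2) + ln (fact (Suc n) :: real)"
        by (subst fact_Suc, subst ln_mult_pos) (auto simp: add_ac)
      thus "stirling_seq (Suc (Suc n)) - stirling_seq (Suc n) = ln (real n + 2) - (real n + 5 / 2) * ln (real n + 2) + (real n + 3 / 2) * ln (real n + 1) + 1"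
        unfolding stirling_seq_def by (simp add: add_ac)
    qed
    also have "\<dots> \<in> O(\<lambda>n. 1 / real n ^ 2)"
      by real_asymp
    finally show "(\<lambda>n. stirling_seq (Suc (Suc n)) - stirling_seq (Suc n)) \<in> O(\<lambda>n. 1 / real n ^ 2)" .
  qed
  hence "convergent (\<lambda>n. \<Sum>k<n. stirling_seq (Suc (Suc k)) - stirling_seq (Suc k))"
    by (simp add: summable_iff_convergent)
  moreover have "(\<lambda>n. \<Sum>k<n. stirling_seq (Suc (Suc k)) - stirling_seq (Suc k)) = (\<lambda>n. stirling_seq (Suc n) - stirling_seq (Suc 0))"
    by (intro ext sum_lessThan_telescope)
  ultimately have "convergent (\<lambda>n. stirling_seq (Suc n))"
    by (simp add: convergent_diff_const_right_iff)
  thus ?thesis by (rule convergent_Suc_iff[THEN iffD1])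
qed

lemma wallis_fact:
  "(\<Prod>k=1..n. (4 * real k ^ 2) / (4 * real k ^ 2 - 1)) = 16 ^ n * fact n ^ 4 / (fact (2 * n) ^ 2 * (2 * real n + 1))"
proof (induction n)
  case (Suc n)
  have 1: "4 * real (Suc n) ^ 2 - 1 = (2 * real n + 1) * (2 * real n + 3)"
    by (simp add: power2_eq_square algebra_simps)
  have 2: "fact (2 * Suc n) = (2 * real n + 2) * (2 * real n + 1) * fact (2 * n)"
    by (simp add: algebra_simps)
  have 3: "fact (Suc n) = (real n + 1) * fact n"
    by (simp add: algebra_simps)
  have "(\<Prod>k=1..Suc n. (4 * real k ^ 2) / (4 * real k ^ 2 - 1)) =
     16 ^ n * fact n ^ 4 / (fact (2 * n) ^ 2 * (2 * real n + 1)) * ((4 * real (Suc n) ^ 2) / ((2 * real n + 1) * (2 * real n + 3)))"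
    by (simp only: prod.cl_ivl_Suc Suc 1) simp
  also have "\<dots> = 16 ^ Suc n * fact (Suc n) ^ 4 / (fact (2 * Suc n) ^ 2 * (2 * real (Suc n) + 1))"
  proof -
    define a b p where "a = real n" and "b = (fact (2 * n) :: real)" and "p = 16 ^ n * (fact n ^ 4 :: real)"
    have pos: "a \<ge> 0" "b > 0" by (auto simp: a_def b_def)
    have "p / (b ^ 2 * (2 * a + 1)) * ((4 * (a + 1) ^ 2) / ((2 * a + 1) * (2 * a + 3))) =
      16 * (a + 1) ^ 4 * p / (((2 * a + 2) * (2 * a + 1) * b) ^ 2 * (2 * a + 3))"
    proof -
      have "2 * a + 1 \<noteq> 0" "2 * a + 3 \<noteq> 0" "a + 1 \<noteq> 0" using pos by auto
      moreover have "2 * a + 2 = 2 * (a + 1)" by simp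
      ultimately show ?thesis using pos
        by (simp add: divide_simps power_mult_distrib) (simp add: power2_eq_square power4_eq_xxxx algebra_simps)
    qed
    thus ?thesis unfolding 2 3 a_def b_def p_def by (simp add: power_mult_distrib mult_ac add_ac)
  qed
  finally show ?case .
qed simp

lemma stirling_seq_tendsto: "stirling_seq \<longlonglongrightarrow> ln (2 * pi) / 2"
proof -
  obtain c where c: "stirling_seq \<longlonglongrightarrow> c" using convergent_stirling_seq by (auto simp: convergent_def)
  have c2: "(\<lambda>n. stirling_seq (2 * n)) \<longlonglongrightarrow> c"
    using LIMSEQ_subseq_LIMSEQ[OF c, of "\<lambda>n. 2 * n"] by (simp add: strict_mono_def o_def)
  have "(\<lambda>n. ln (\<Prod>k=1..n. (4 * real k ^ 2) / (4 * real k ^ 2 - 1))) \<longlonglongrightarrow> ln (pi / 2)"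
    by (intro tendsto_ln wallis) auto
  moreover have "\<forall>\<^sub>F n in sequentially. ln (\<Prod>k=1..n. (4 * real k ^ 2) / (4 * real k ^ 2 - 1)) =
     4 * stirling_seq n - 2 * stirling_seq (2 * n) + (2 * ln (real n) - ln (real n) - ln (2 * real n + 1) - ln 2)"
    using eventually_gt_at_top[of 0]
  proof eventually_elim
    case (elim n)
    have "ln (16 ^ n * fact n ^ 4 / (fact (2 * n) ^ 2 * (2 * real n + 1))) =
       real n * ln (16 :: real) + 4 * ln (fact n) - (2 * ln (fact (2 * n)) + ln (2 * real n + 1))"
      by (simp add: ln_div ln_mult_pos ln_realpow)
    moreover have "ln (16 :: real) = 4 * ln 2"
      using ln_realpow[of "2::real" 4] by simp
    moreover have "ln (real (2 * n)) = ln 2 + ln (real n)"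
      using elim by (simp add: ln_mult_pos)
    ultimately show ?case unfolding wallis_fact stirling_seq_def
      by (simp add: algebra_simps)
  qed
  ultimately have "(\<lambda>n. 4 * stirling_seq n - 2 * stirling_seq (2 * n) + (2 * ln (real n) - ln (real n) - ln (2 * real n + 1) - ln 2)) \<longlonglongrightarrow> ln (pi / 2)"
    by (rule Lim_transform_eventually)
  moreover have "(\<lambda>n. 4 * stirling_seq n - 2 * stirling_seq (2 * n) + (2 * ln (real n) - ln (real n) - ln (2 * real n + 1) - ln 2)) \<longlonglongrightarrow> 4 * c - 2 * c + (- 2 * ln 2)"
  proof (intro tendsto_intros c c2)
    show "(\<lambda>n. 2 * ln (real n) - ln (real n) - ln (2 * real n + 1) - ln 2) \<longlonglongrightarrow> - 2 * ln 2"
      by real_asymp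
  qed
  ultimately have "ln (pi / 2) = 4 * c - 2 * c + (- 2 * ln 2)"
    by (rule LIMSEQ_unique)
  hence "c = ln (2 * pi) / 2" by (simp add: ln_div ln_mult_pos)
  with c show ?thesis by simp
qed

section \<open>The Barnes function\<close>

text \<open>
  The logarithm of the factor \<open>k + 1\<close> in the Weierstrass product of \<open>G (1 + u)\<close>.
\<close>

definition barnes_term :: "real \<Rightarrow> nat \<Rightarrow> real" where
  "barnes_term u k = real (Suc k) * ln (1 + u / real (Suc k)) + (u\<^sup>2 / (2 * real (Suc k)) - u)"

lemma summable_barnes_term:
  assumes "u > 0"
  shows "summable (barnes_term u)"
proof (rule summable_comparison_test_bigo)
  show "summable (\<lambda>n. norm (1 / real n ^ 2))"
    using inverse_power_summable[of 2, where 'a = real] by (simp add: divide_inverse)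
  have "barnes_term u = (\<lambda>k. (real k + 1) * ln (1 + u / (real k + 1)) + u * u / 2 / (real k + 1) - u)"
    by (rule ext) (simp add: barnes_term_def power2_eq_square add_ac)
  also have "\<dots> \<in> O(\<lambda>n. 1 / real n ^ 2)"
    using assms by real_asymp
  finally show "barnes_term u \<in> O(\<lambda>n. 1 / real n ^ 2)" .
qed

lemma ln_Barnes_G:
  assumes "u > 0"
  shows "ln (Barnes_G (1 + u)) = u / 2 * ln (2 * pi) - 1 / 2 * (euler_mascheroni * u\<^sup>2 + u\<^sup>2 + u) + (\<Sum>k. barnes_term u k)"
proof -
  have "(1 + u / real (Suc k)) ^ Suc k * exp (u\<^sup>2 / (2 * real (Suc k)) - u) = exp (barnes_term u k)" for k
  proof -
    have "exp (real (Suc k) * ln (1 + u / real (Suc k))) = (1 + u / real (Suc k)) ^ Suc k"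
      by (subst exp_of_nat_mult) (use assms in \<open>simp add: add_pos_pos\<close>)
    thus ?thesis unfolding barnes_term_def exp_add by simp
  qed
  hence "(\<Prod>k. (1 + u / real (Suc k)) ^ Suc k * exp (u\<^sup>2 / (2 * real (Suc k)) - u)) = exp (\<Sum>k. barnes_term u k)"
    using prodinf_exp[OF summable_barnes_term[OF assms]] by simp
  hence "Barnes_G (1 + u) = (2 * pi) powr (u / 2) * exp (- (1 / 2) * (euler_mascheroni * u\<^sup>2 + u\<^sup>2 + u)) * exp (\<Sum>k. barnes_term u k)"
    by (simp add: Barnes_G_def)
  thus ?thesis by (simp add: ln_mult_pos ln_powr)
qed

lemma sum_barnes_term_tendsto: "u > 0 \<Longrightarrow> (\<lambda>N. \<Sum>k<N. barnes_term u k) \<longlonglongrightarrow> (\<Sum>k. barnes_term u k)"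
  by (rule summable_LIMSEQ[OF summable_barnes_term])

lemma ln_Barnes_G_2: "ln (Barnes_G (1 + 1)) = 0"
proof -
  have eq: "(\<Sum>k<N. barnes_term 1 k) = real N * ln (real N + 1) - ln (fact N) + harm N / 2 - real N" for N
  proof (induction N)
    case (Suc N)
    have 1: "ln (fact (Suc N)) = ln (real N + 1) + ln (fact N :: real)"
      by (subst fact_Suc, subst ln_mult_pos) (auto simp: add_ac)
    have 2: "harm (Suc N) = harm N + 1 / (real N + 1)"
      by (simp add: harm_Suc field_simps)
    have "1 + 1 / real (Suc N) = (real N + 2) / (real N + 1)"
      by (simp add: field_simps)
    hence 3: "ln (1 + 1 / real (Suc N)) = ln (real N + 2) - ln (real N + 1)"
      by (simp only:) (simp add: ln_div)
    have "barnes_term 1 N = (real N + 1) * (ln (real N + 2) - ln (real N + 1)) + 1 / (real N + 1) / 2 - 1"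
      unfolding barnes_term_def 3 by (simp add: field_simps)
    thus ?case unfolding sum.lessThan_Suc Suc 1 2
      by (simp add: algebra_simps add_divide_distrib)
  qed (simp add: harm_def)
  have "\<forall>\<^sub>F N in sequentially. (\<Sum>k<N. barnes_term 1 k) = real N * ln (real N + 1) - real N * ln (real N) - stirling_seq N + (harm N - ln (real N)) / 2"
    by (intro always_eventually allI, subst eq) (simp add: stirling_seq_def field_simps)
  moreover have "(\<lambda>N. real N * ln (real N + 1) - real N * ln (real N) - stirling_seq N + (harm N - ln (real N)) / 2) \<longlonglongrightarrow> 1 - ln (2 * pi) / 2 + euler_mascheroni / 2"
  proof (intro tendsto_intros stirling_seq_tendsto euler_mascheroni_LIMSEQ)
    show "(\<lambda>N. real N * ln (real N + 1) - real N * ln (real N)) \<longlonglongrightarrow> 1" by real_asymp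
  qed auto
  ultimately have "(\<lambda>N. \<Sum>k<N. barnes_term 1 k) \<longlonglongrightarrow> 1 - ln (2 * pi) / 2 + euler_mascheroni / 2"
    by (simp add: filterlim_cong)
  hence "(\<Sum>k. barnes_term 1 k) = 1 - ln (2 * pi) / 2 + euler_mascheroni / 2"
    using sum_barnes_term_tendsto[of 1] LIMSEQ_unique by force
  thus ?thesis
    by (subst ln_Barnes_G) (simp_all add: field_simps)
qed


section \<open>Comparison of the two sides\<close>

text \<open>
  The part of the partial sums that does not depend on \<open>u\<close>.
\<close>

definition barnes_limit_seq :: "nat \<Rightarrow> real" where
  "barnes_limit_seq N = log_head (real (Suc N)) - 2 * (\<Sum>k<N. real (Suc k) * ln (real (Suc k))) - real N * (real N + 1) / 2"

text \<open>
  The cancellation behind the theorem: the sums of \<open>ln (u + k)\<close> and of \<open>(u + k) ln (u + k)\<close>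
  contributed by \<open>ln G (1 + u)\<close>, by \<open>u ln \<Gamma>(u)\<close> and by the difference equation of \<open>log_series\<close> annihilate
  one another.
\<close>

lemma barnes_partial_sums:
  assumes u: "u > 0"
  shows "u * ln (2 * pi) - (euler_mascheroni * u\<^sup>2 + u\<^sup>2 + u) + 2 * (\<Sum>k<N. barnes_term u k)
      - 2 * u * ln_Gamma_series u N + log_head (u + real (Suc N))
      - (\<Sum>j<Suc N. 2 * (u + real j) * ln (u + real j) + (u + real j)) =
    barnes_limit_seq N + (u * (ln (2 * pi) - 2 * stirling_seq N) + u\<^sup>2 * ((harm N - ln (real N)) - euler_mascheroni)
      + (log_head (u + real (Suc N)) - log_head (real (Suc N)) - u\<^sup>2 * ln (real N) - 2 * u * (real N + 1 / 2) * ln (real N)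
         - u\<^sup>2 - u - (real N + 1) * u))"
proof -
  define L where "L = (\<lambda>k. ln (u + real (Suc k)))"
  have ln1: "ln (1 + u / real (Suc k)) = L k - ln (real (Suc k))" for k
  proof -
    have "1 + u / real (Suc k) = (u + real (Suc k)) / real (Suc k)"
      by (simp add: field_simps)
    thus ?thesis using u by (simp only: L_def) (simp add: ln_div add_pos_pos)
  qed
  have fact: "(\<Sum>k<N. ln (real (Suc k))) = ln (fact N)"
  proof (induction N)
    case (Suc N)
    have "ln (fact (Suc N)) = ln (real (Suc N)) + ln (fact N :: real)"
      by (subst fact_Suc, subst ln_mult_pos) auto
    with Suc show ?case by simp
  qed simp
  have harm: "harm N = (\<Sum>k<N. 1 / real (Suc k))"
    by (simp add: harm_def sum.atLeast1_atMost_eq inverse_eq_divide)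
  have g: "(\<Sum>k<N. barnes_term u k) = (\<Sum>k<N. real (Suc k) * L k) - (\<Sum>k<N. real (Suc k) * ln (real (Suc k)))
      + u\<^sup>2 / 2 * harm N - real N * u"
    unfolding barnes_term_def ln1 harm by (simp add: sum.distrib sum_subtractf sum_distrib_left algebra_simps)
  have G: "ln_Gamma_series u N = u * ln (real N) - ln u - (\<Sum>k<N. L k) + ln (fact N)"
  proof -
    have "(\<Sum>k=1..N. ln (u / of_nat k + 1)) = (\<Sum>k<N. ln (1 + u / real (Suc k)))"
      by (simp add: sum.atLeast1_atMost_eq add_ac)
    thus ?thesis
      unfolding ln_Gamma_series_def ln1 by (simp only: sum_subtractf fact)
  qed
  have gauss: "(\<Sum>j<N. real (Suc j)) = real N * (real N + 1) / 2" for N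
    by (induction N) (auto simp: field_simps)
  have S: "(\<Sum>j<Suc N. 2 * (u + real j) * ln (u + real j) + (u + real j)) =
     2 * u * ln u + 2 * u * (\<Sum>k<N. L k) + 2 * (\<Sum>k<N. real (Suc k) * L k) + (real N + 1) * u + real N * (real N + 1) / 2"
    unfolding sum.lessThan_Suc_shift gauss[symmetric]
    by (simp add: L_def sum.distrib sum_distrib_left algebra_simps)
  show ?thesis
    unfolding g G S barnes_limit_seq_def stirling_seq_def by (simp add: algebra_simps power2_eq_square)
qed

lemma log_head_shift_asymptotics:
  fixes a :: real
  assumes a: "a > 0"
  shows "(\<lambda>N. log_head (real N + a) - (((real N)\<^sup>2 + (2 * a - 1) * real N + (a\<^sup>2 - a + 1 / 6)) * ln (real N) + (a - 1 / 2) * real N))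
           \<longlonglongrightarrow> 3 / 2 * a\<^sup>2 - 3 / 2 * a + 1 / 4"
proof -
  define r where "r = (\<lambda>y. log_head y - ((y\<^sup>2 - y + 1 / 6) * ln y - y / 2 + 1 / 4))"
  define d where "d = (\<lambda>N. ln (real N + a) - ln (real N))"
  have "((\<lambda>y. (y + 1)\<^sup>2 * (ln (y + 1) - ln y) - y) \<longlongrightarrow> 3 / 2) (at_top :: real filter)"
    by real_asymp
  moreover have "((\<lambda>y. (y + 2)\<^sup>2 * (ln (y + 2) - ln y) - 2 * y) \<longlongrightarrow> 6) (at_top :: real filter)"
    by real_asymp
  ultimately have "((\<lambda>y. - (7 / 6) * ((y + 1)\<^sup>2 * (ln (y + 1) - ln y) - y)
      + 1 / 3 * ((y + 2)\<^sup>2 * (ln (y + 2) - ln y) - 2 * y) - 1 / 4) \<longlongrightarrow> - (7 / 6) * (3 / 2) + 1 / 3 * 6 - 1 / 4) (at_top :: real filter)"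
    by (intro tendsto_intros)
  also have "(\<lambda>y. - (7 / 6) * ((y + 1)\<^sup>2 * (ln (y + 1) - ln y) - y)
      + 1 / 3 * ((y + 2)\<^sup>2 * (ln (y + 2) - ln y) - 2 * y) - 1 / 4) = r"
    by (rule ext) (simp add: r_def log_head_def field_simps power2_eq_square)
  finally have "(r \<longlongrightarrow> 0) at_top"
    by simp
  moreover have "filterlim (\<lambda>N. real N + a) at_top sequentially"
    by real_asymp
  ultimately have r: "(\<lambda>N. r (real N + a)) \<longlonglongrightarrow> 0"
    by (rule filterlim_compose)
  have d0: "d \<longlonglongrightarrow> 0" unfolding d_def by real_asymp
  have d1: "(\<lambda>N. real N * d N) \<longlonglongrightarrow> a"
    unfolding d_def using a by real_asymp
  have d2: "(\<lambda>N. (real N)\<^sup>2 * d N - a * real N) \<longlonglongrightarrow> - (a * a / 2)"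
    unfolding d_def using a by real_asymp
  have "(\<lambda>N. r (real N + a) + ((real N)\<^sup>2 * d N - a * real N) + (2 * a - 1) * (real N * d N)
          + (a\<^sup>2 - a + 1 / 6) * d N + (1 / 4 - a / 2))
        \<longlonglongrightarrow> 0 + (- (a * a / 2)) + (2 * a - 1) * a + (a\<^sup>2 - a + 1 / 6) * 0 + (1 / 4 - a / 2)"
    by (intro tendsto_intros r d0 d1 d2)
  also have "0 + (- (a * a / 2)) + (2 * a - 1) * a + (a\<^sup>2 - a + 1 / 6) * 0 + (1 / 4 - a / 2) = 3 / 2 * a\<^sup>2 - 3 / 2 * a + 1 / 4"
    by (simp add: field_simps power2_eq_square)
  also have "(\<lambda>N. r (real N + a) + ((real N)\<^sup>2 * d N - a * real N) + (2 * a - 1) * (real N * d N)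
          + (a\<^sup>2 - a + 1 / 6) * d N + (1 / 4 - a / 2)) =
     (\<lambda>N. log_head (real N + a) - (((real N)\<^sup>2 + (2 * a - 1) * real N + (a\<^sup>2 - a + 1 / 6)) * ln (real N) + (a - 1 / 2) * real N))"
    by (rule ext) (simp add: r_def d_def field_simps power2_eq_square)
  finally show ?thesis .
qed

text \<open>
  One and the same sequence converges to an expression in \<open>u\<close>, for every \<open>u > 0\<close>; hence that
  expression is constant in \<open>u\<close>.
\<close>

lemma barnes_limit_seq_tendsto:
  assumes u: "u > 0"
  shows "barnes_limit_seq \<longlonglongrightarrow> 2 * ln (Barnes_G (1 + u)) - 2 * u * ln (Gamma u) + log_series u - (u\<^sup>2 / 2 - u / 2)"
proof -
  let ?T = "\<lambda>N. u * ln (2 * pi) - (euler_mascheroni * u\<^sup>2 + u\<^sup>2 + u) + 2 * (\<Sum>k<N. barnes_term u k)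
      - 2 * u * ln_Gamma_series u N + log_head (u + real (Suc N))
      - (\<Sum>j<Suc N. 2 * (u + real j) * ln (u + real j) + (u + real j))"
  let ?A = "\<lambda>N. u * (ln (2 * pi) - 2 * stirling_seq N) + u\<^sup>2 * ((harm N - ln (real N)) - euler_mascheroni)
      + (log_head (u + real (Suc N)) - log_head (real (Suc N)) - u\<^sup>2 * ln (real N) - 2 * u * (real N + 1 / 2) * ln (real N)
         - u\<^sup>2 - u - (real N + 1) * u)"
  have log_series: "log_series u = log_series (u + real (Suc N)) - (\<Sum>j<Suc N. 2 * (u + real j) * ln (u + real j) + (u + real j))" for N
    using log_series_shift_nat[OF u, of "Suc N"] by simp
  have "(\<lambda>N. u * ln (2 * pi) - (euler_mascheroni * u\<^sup>2 + u\<^sup>2 + u) + 2 * (\<Sum>k<N. barnes_term u k)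
      - 2 * u * ln_Gamma_series u N + log_series u - (log_series (u + real (Suc N)) - log_head (u + real (Suc N)))) \<longlonglongrightarrow>
      u * ln (2 * pi) - (euler_mascheroni * u\<^sup>2 + u\<^sup>2 + u) + 2 * (\<Sum>k. barnes_term u k)
      - 2 * u * ln_Gamma u + log_series u - 0"
    by (intro tendsto_intros sum_barnes_term_tendsto ln_Gamma_real_LIMSEQ log_series_minus_head_tendsto u)
  also have "(\<lambda>N. u * ln (2 * pi) - (euler_mascheroni * u\<^sup>2 + u\<^sup>2 + u) + 2 * (\<Sum>k<N. barnes_term u k)
      - 2 * u * ln_Gamma_series u N + log_series u - (log_series (u + real (Suc N)) - log_head (u + real (Suc N)))) = ?T"
    by (rule ext, use log_series in \<open>simp add: algebra_simps\<close>)
  also have "u * ln (2 * pi) - (euler_mascheroni * u\<^sup>2 + u\<^sup>2 + u) + 2 * (\<Sum>k. barnes_term u k) - 2 * u * ln_Gamma u + log_series u - 0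
      = 2 * ln (Barnes_G (1 + u)) - 2 * u * ln (Gamma u) + log_series u"
    using u by (simp add: ln_Barnes_G ln_Gamma_real_pos field_simps)
  finally have T: "?T \<longlonglongrightarrow> 2 * ln (Barnes_G (1 + u)) - 2 * u * ln (Gamma u) + log_series u" .
  have X: "(\<lambda>N. log_head (u + real (Suc N)) - log_head (real (Suc N)) - u\<^sup>2 * ln (real N) - 2 * u * (real N + 1 / 2) * ln (real N)
         - u\<^sup>2 - u - (real N + 1) * u) \<longlonglongrightarrow> u\<^sup>2 / 2 - u / 2"
  proof -
    let ?h = "\<lambda>a N. log_head (real N + a) - (((real N)\<^sup>2 + (2 * a - 1) * real N + (a\<^sup>2 - a + 1 / 6)) * ln (real N) + (a - 1 / 2) * real N)"
    have "(\<lambda>N. ?h (u + 1) N - ?h 1 N - u\<^sup>2 - 2 * u) \<longlonglongrightarrow>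
        (3 / 2 * (u + 1)\<^sup>2 - 3 / 2 * (u + 1) + 1 / 4) - (3 / 2 * 1\<^sup>2 - 3 / 2 * 1 + 1 / 4) - u\<^sup>2 - 2 * u"
      by (intro tendsto_diff tendsto_const log_head_shift_asymptotics) (use u in auto)
    also have "(3 / 2 * (u + 1)\<^sup>2 - 3 / 2 * (u + 1) + 1 / 4) - (3 / 2 * 1\<^sup>2 - 3 / 2 * 1 + 1 / 4) - u\<^sup>2 - 2 * u = u\<^sup>2 / 2 - u / 2"
      by (simp add: field_simps power2_eq_square)
    also have "(\<lambda>N. ?h (u + 1) N - ?h 1 N - u\<^sup>2 - 2 * u) =
        (\<lambda>N. log_head (u + real (Suc N)) - log_head (real (Suc N)) - u\<^sup>2 * ln (real N) - 2 * u * (real N + 1 / 2) * ln (real N)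
           - u\<^sup>2 - u - (real N + 1) * u)"
    proof
      fix N
      have "real N + (u + 1) = u + real (Suc N)" "real N + 1 = real (Suc N)" by simp_all
      thus "?h (u + 1) N - ?h 1 N - u\<^sup>2 - 2 * u =
         log_head (u + real (Suc N)) - log_head (real (Suc N)) - u\<^sup>2 * ln (real N) - 2 * u * (real N + 1 / 2) * ln (real N)
           - u\<^sup>2 - u - (real N + 1) * u"
        by (simp add: field_simps power2_eq_square)
    qed
    finally show ?thesis .
  qed
  have "?A \<longlonglongrightarrow> u * (ln (2 * pi) - 2 * (ln (2 * pi) / 2)) + u\<^sup>2 * (euler_mascheroni - euler_mascheroni) + (u\<^sup>2 / 2 - u / 2)"
    by (intro X tendsto_add tendsto_mult tendsto_diff tendsto_const stirling_seq_tendsto euler_mascheroni_LIMSEQ)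
  hence A: "?A \<longlonglongrightarrow> u\<^sup>2 / 2 - u / 2" by simp
  have "?T N - ?A N = barnes_limit_seq N" for N
    by (subst barnes_partial_sums[OF u]) simp
  with tendsto_diff[OF T A] show ?thesis
    by (simp only:)
qed

theorem mainTheorem4:
  fixes u :: real
  assumes "u > 0"
  defines "a \<equiv> \<lambda>n. 1 / real (n + 1) *
             (\<Sum>k=0..n. real (n choose k) * (- 1) ^ k * (u + real k)\<^sup>2 * ln (u + real k))"
  shows "summable a \<and>
    complex_of_real (2 * ln (Barnes_G (1 + u))) =
      complex_of_real (- (\<Sum>n. a n) + 2 * u * ln (Gamma u) + 2 * u\<^sup>2 - u)
      + 2 * deriv zeta (- 1)
      + complex_of_real (- 11 / 12 - 1 / 2 * (u - 1) * (3 * u + 2))"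
proof
  have a: "a = log_term u" unfolding a_def by (rule ext) (simp add: log_term_def)
  show "summable a" unfolding a by (rule summable_log_term) fact
  \<comment> \<open>The constant is read off at \<open>u = 1\<close>, where \<open>G(2) = \<Gamma>(1) = 1\<close>.\<close>
  have "2 * ln (Barnes_G (1 + u)) - 2 * u * ln (Gamma u) + log_series u - (u\<^sup>2 / 2 - u / 2) =
        2 * ln (Barnes_G (1 + 1)) - 2 * 1 * ln (Gamma 1) + log_series 1 - (1\<^sup>2 / 2 - 1 / 2)"
    by (rule LIMSEQ_unique[OF barnes_limit_seq_tendsto barnes_limit_seq_tendsto]) (use assms in auto)
  hence "2 * ln (Barnes_G (1 + u)) = - log_series u + 2 * u * ln (Gamma u) + u\<^sup>2 / 2 - u / 2 + log_series 1"
    unfolding ln_Barnes_G_2 by simp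
  also have "\<dots> = (- (\<Sum>n. a n) + 2 * u * ln (Gamma u) + 2 * u\<^sup>2 - u) + 2 * (log_series 1 / 2 - 1 / 24)
      + (- 11 / 12 - 1 / 2 * (u - 1) * (3 * u + 2))"
    unfolding a log_series_def[symmetric] by (simp add: field_simps power2_eq_square)
  finally have eq: "2 * ln (Barnes_G (1 + u)) = \<dots>" .
  have "deriv zeta (- 1) = complex_of_real (log_series 1 / 2 - 1 / 24)"
    by (simp add: deriv_zeta_minus_one log_series_c_eq)
  thus "complex_of_real (2 * ln (Barnes_G (1 + u))) =
      complex_of_real (- (\<Sum>n. a n) + 2 * u * ln (Gamma u) + 2 * u\<^sup>2 - u)
      + 2 * deriv zeta (- 1)
      + complex_of_real (- 11 / 12 - 1 / 2 * (u - 1) * (3 * u + 2))"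
    unfolding eq by simp
qed

end
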